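(* Let $H$ be a quaternion skew field with centre $F$. Then the following are equivalent. (a) $F$ is a formally real Pythagorean field, and $H$ is the ordinary quaternion skew field over $F$. (b) All maximal subfields of $H$ are mutually $F$-isomorphic. (c) The Clifford parallelisms $\parallel_{\ell}$ and $\parallel_{r}$ are the only Clifford-like parallelisms of the projective double space $(\mathbb{P}(H),\parallel_{\ell},\parallel_{r})$.
   Context: A quaternion skew field $H$ with centre $F$ is a quaternion algebra over the field $F$ (of any characteristic), $4$-dimensional over $F$, that is a skew field with centre $F$; $H^*:=H\setminus\{0\}$. "Maximal subfield" means maximal commutative subfield; these are precisely the two-dimensional $F$-subalgebras of $H$. Two of them are $F$-isomorphic if there is a ring isomorphism between them fixing $F$ elementwise. In this statement a field $F$ is called formally real if $-1$ is not a square in $F$, and Pythagorean if the sum of any two squares in $F$ is a square in $F$. For a formally real field $F$ put $K:=F(i)$ with $i^2=-1$. The ordinary quaternion algebra $(K/F,-1)$ over $F$ is (up to $F$-isomorphism) the ring of all $2\times2$ matrices $$\begin{pmatrix}x_1+ix_2&y_1+iy_2\\-y_1+iy_2&x_1-ix_2\end{pmatrix},\qquad x_1,x_2,y_1,y_2\in F,$$ over $K$, where $x\in F$ is identified with $\operatorname{diag}(x,x)$. It is a skew field if, and only if, $-1$ is not a sum of two squares in $F$, in which case it is called the ordinary quaternion skew field over $F$. The projective space $\mathbb{P}(H)$ is the set of all subspaces of the $F$-vector space $H$; its points and lines are the subspaces of vector dimension one and two, respectively. For lines $M,N$: $M\parallel_{\ell}N$ if there is a $c\in H^*$ with $cM=N$;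 $M\parallel_{r}N$ if there is a $d\in H^*$ with $Md=N$. A parallelism on a projective space is an equivalence relation on its set of lines such that each point is incident with precisely one line from each equivalence class. A projective space with parallelisms $\parallel_{\ell}$ and $\parallel_{r}$ is a projective double space if for all triangles $p_0,p_1,p_2$ the line through $p_2$ left parallel to the join of $p_0$ and $p_1$ and the line through $p_1$ right parallel to the join of $p_0$ and $p_2$ have a common point; $\parallel_{\ell}$ and $\parallel_{r}$ are then called its Clifford parallelisms. It is known that $(\mathbb{P}(H),\parallel_{\ell},\parallel_{r})$ is a projective double space. A Clifford-like parallelism of it is a parallelism $\parallel$ on $\mathbb{P}(H)$ such that for all lines $M,N$: $M\parallel N$ implies ($M\parallel_{\ell}N$ or $M\parallel_{r}N$). *)

theory Defs
  imports "HOL-Analysis.Analysis"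
begin

section \<open>Fields\<close>

text \<open>In this development ``formally real'' only means that \<open>-1\<close> is not a square.\<close>

definition formally_real :: "'f::field itself \<Rightarrow> bool" where
  "formally_real _ \<longleftrightarrow> \<not> (\<exists>x::'f. x\<^sup>2 = - 1)"

definition pythagorean :: "'f::field itself \<Rightarrow> bool" where
  "pythagorean _ \<longleftrightarrow> (\<forall>x y::'f. \<exists>z. x\<^sup>2 + y\<^sup>2 = z\<^sup>2)"


section \<open>The extension \<open>F(i)\<close> with \<open>i\<^sup>2 = -1\<close>\<close>

text \<open>
  \<open>Adj x y\<close> stands for \<open>x + i y\<close>.  The construction yields a commutative ring over every
  field \<open>F\<close>; it is the field \<open>F(i)\<close> when \<open>-1\<close> is not a square in \<open>F\<close>, see
  \<open>adjoin_i_inverse\<close> below.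
\<close>

datatype 'f adjoin_i = Adj (re: 'f) (im: 'f)

instantiation adjoin_i :: (field) comm_ring_1
begin

definition "0 = Adj 0 0"
definition "1 = Adj 1 0"
definition "z + w = Adj (re z + re w) (im z + im w)"
definition "z - w = Adj (re z - re w) (im z - im w)"
definition "- z = Adj (- re z) (- im z)"
definition "z * w = Adj (re z * re w - im z * im w) (re z * im w + im z * re w)"

instance
  by standard
    (auto simp: zero_adjoin_i_def one_adjoin_i_def plus_adjoin_i_def minus_adjoin_i_def
      uminus_adjoin_i_def times_adjoin_i_def algebra_simps)

end

lemma adjoin_i_square: "Adj 0 1 * Adj 0 1 = (- 1 :: 'f::field adjoin_i)"
  by (simp add: one_adjoin_i_def uminus_adjoin_i_def times_adjoin_i_def)

lemma adjoin_i_inverse: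
  fixes z :: "'f::field adjoin_i"
  assumes "formally_real TYPE('f)" and "z \<noteq> 0"
  shows "\<exists>w. z * w = 1"
proof -
  define n where "n = (re z)\<^sup>2 + (im z)\<^sup>2"
  have "n \<noteq> 0"
  proof
    assume n: "n = 0"
    show False
    proof (cases "im z = 0")
      case True
      then have "re z = 0" using n by (simp add: n_def)
      with True assms(2) show False
        by (cases z) (simp add: zero_adjoin_i_def)
    next
      case False
      have "(re z)\<^sup>2 = - (im z)\<^sup>2" using n by (simp add: n_def eq_neg_iff_add_eq_0)
      then have "(re z / im z)\<^sup>2 = - 1" using False by (simp add: power_divide)
      with assms(1) show False unfolding formally_real_def by blast
    qed
  qed
  moreover have "z * Adj (re z / n) (- im z / n) = Adj (n / n) 0"
    by (simp add: times_adjoin_i_def n_def power2_eq_square flip: add_divide_distrib)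
  ultimately show ?thesis
    by (auto simp: one_adjoin_i_def)
qed


section \<open>Commutative subfields of a skew field\<close>

definition commutative_subfield :: "'h::division_ring set \<Rightarrow> bool" where
  "commutative_subfield K \<longleftrightarrow>
     0 \<in> K \<and> 1 \<in> K \<and>
     (\<forall>x\<in>K. \<forall>y\<in>K. x - y \<in> K \<and> x * y \<in> K \<and> x * y = y * x) \<and>
     (\<forall>x\<in>K. inverse x \<in> K)"

definition maximal_subfield :: "'h::division_ring set \<Rightarrow> bool" where
  "maximal_subfield K \<longleftrightarrow>
     commutative_subfield K \<and> (\<forall>L. commutative_subfield L \<and> K \<subseteq> L \<longrightarrow> L = K)"


section \<open>Skew fields with a prescribed centre\<close>

text \<open>
  The centre \<open>F\<close> of the skew field is represented by a separate field type, together with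
  the embedding of that field onto the centre.
\<close>

locale skew_field_with_centre =
  fixes emb :: "'f::field \<Rightarrow> 'h::division_ring"
  assumes emb_add: "emb (a + b) = emb a + emb b"
    and emb_mult: "emb (a * b) = emb a * emb b"
    and emb_one: "emb 1 = 1"
    and range_emb: "range emb = {z. \<forall>x. z * x = x * z}"

sublocale skew_field_with_centre \<subseteq> vector_space "\<lambda>a x. emb a * x"
  by unfold_locales
    (simp_all add: emb_add emb_mult emb_one distrib_left distrib_right mult.assoc)

context skew_field_with_centre
begin

definition F_isomorphic :: "'h set \<Rightarrow> 'h set \<Rightarrow> bool" where
  "F_isomorphic K L \<longleftrightarrow>
     (\<exists>\<phi>. bij_betw \<phi> K L \<and>
        (\<forall>x\<in>K. \<forall>y\<in>K. \<phi> (x + y) = \<phi> x + \<phi> y \<and> \<phi> (x * y) = \<phi> x * \<phi> y) \<and>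
        (\<forall>a. \<phi> (emb a) = emb a))"

text \<open>
  The classical presentations by generators, with \<open>1, i, j, i j\<close> spanning the algebra; in
  dimension four they are then a basis.
\<close>

definition quaternion_algebra :: bool where
  "quaternion_algebra \<longleftrightarrow>
     dim (UNIV :: 'h set) = 4 \<and>
     (\<exists>(a::'f) (b::'f) (i::'h) (j::'h).
        span {1, i, j, i * j} = UNIV \<and>
        (if (2::'f) \<noteq> 0
         then a \<noteq> 0 \<and> b \<noteq> 0 \<and> i * i = emb a \<and> j * j = emb b \<and> j * i = - (i * j)
         else b \<noteq> 0 \<and> i * i + i = emb a \<and> j * j = emb b \<and> j * i = (i + 1) * j))"

end

locale quaternion_skew_field = skew_field_with_centre emb
  for emb :: "'f::field \<Rightarrow> 'h::division_ring" +
  assumes quaternion_algebra: quaternion_algebra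


section \<open>The ordinary quaternion algebra\<close>

definition ordinary_quaternion_matrix :: "'f::field \<Rightarrow> 'f \<Rightarrow> 'f \<Rightarrow> 'f \<Rightarrow> 'f adjoin_i^2^2" where
  "ordinary_quaternion_matrix x1 x2 y1 y2 =
     vector [vector [Adj x1 x2, Adj y1 y2],
             vector [Adj (- y1) y2, Adj x1 (- x2)]]"

definition ordinary_quaternion_algebra :: "('f::field adjoin_i^2^2) set" where
  "ordinary_quaternion_algebra = {ordinary_quaternion_matrix x1 x2 y1 y2 | x1 x2 y1 y2. True}"

text \<open>
  \<open>mat (Adj a 0)\<close> is the diagonal matrix \<open>diag(a, a)\<close>.  Since \<open>'h\<close> is a skew field, an
  isomorphism already forces the ordinary quaternion algebra to be one.
\<close>

definition (in skew_field_with_centre) is_ordinary_quaternion_skew_field :: bool where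
  "is_ordinary_quaternion_skew_field \<longleftrightarrow>
     (\<exists>\<phi> :: 'h \<Rightarrow> 'f adjoin_i^2^2.
        bij_betw \<phi> UNIV ordinary_quaternion_algebra \<and>
        (\<forall>x y. \<phi> (x + y) = \<phi> x + \<phi> y \<and> \<phi> (x * y) = \<phi> x ** \<phi> y) \<and>
        (\<forall>a. \<phi> (emb a) = mat (Adj a 0)))"


section \<open>Parallelisms on the projective space of a skew field\<close>

context skew_field_with_centre
begin

definition points :: "'h set set" where
  "points = {P. subspace P \<and> dim P = 1}"

definition lines :: "'h set set" where
  "lines = {M. subspace M \<and> dim M = 2}"

definition left_parallel :: "('h set \<times> 'h set) set" where
  "left_parallel =
     {(M, N). M \<in> lines \<and> N \<in> lines \<and> (\<exists>c. c \<noteq> 0 \<and> (\<lambda>x. c * x) ` M = N)}"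

definition right_parallel :: "('h set \<times> 'h set) set" where
  "right_parallel =
     {(M, N). M \<in> lines \<and> N \<in> lines \<and> (\<exists>d. d \<noteq> 0 \<and> (\<lambda>x. x * d) ` M = N)}"

definition parallelism :: "('h set \<times> 'h set) set \<Rightarrow> bool" where
  "parallelism R \<longleftrightarrow>
     equiv lines R \<and> (\<forall>P\<in>points. \<forall>C\<in>lines // R. \<exists>!M. M \<in> C \<and> P \<subseteq> M)"

definition clifford_like :: "('h set \<times> 'h set) set \<Rightarrow> bool" where
  "clifford_like R \<longleftrightarrow> parallelism R \<and> R \<subseteq> left_parallel \<union> right_parallel"

end

end

theory Submission
  imports Defs
begin

text \<open>
  A line through the point \<open>F 1\<close> is the same thing as a maximal subfield \<open>F(x) = F + F x\<close> of \<open>H\<close>, and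
  also the same thing as the centralizer of a noncentral element \<open>x\<close> (\<open>centralizer_eq_span\<close>).
  By the Skolem--Noether theorem for quadratic subfields, two maximal subfields are \<open>F\<close>-isomorphic
  iff they are conjugate (\<open>F_isomorphic_iff_conjugate\<close>).  So condition (b) says that all maximal
  subfields are conjugate, and it is this condition that is compared with (a) and with (c).

  Every line is a left coset \<open>p K\<close> of a unique maximal subfield \<open>K\<close>, its left direction, and a right
  coset \<open>(p K p\<inverse>) p\<close> of a conjugate one, its right direction.  Lines are left (right) parallel iff
  they have the same left (right) direction.  A class of a Clifford-like parallelism is a full left
  class or a full right class.  The left class of \<open>K\<close> and the right class of \<open>L\<close> have a line
  \<open>c K = L c\<close> in common iff \<open>K\<close> and \<open>L\<close> are conjugate.  Hence the choice of left or right has to be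
  constant on conjugacy classes, and every choice that is constant on them yields a Clifford-like
  parallelism (\<open>clifford_like_mixed_parallel\<close>).  If there is just one conjugacy class,
  only the two Clifford parallelisms remain (\<open>clifford_like_unique_if_conjugate\<close>); if there are
  several, one of them may be treated differently from the others (\<open>ex_other_clifford_like\<close>).

  For (a) and (b), let \<open>H\<close> be ordinary over a formally real Pythagorean field.  Then every maximal
  subfield contains a square root of \<open>-1\<close>, and such square roots are conjugate.  Conversely,
  if all maximal subfields are conjugate, then the generators \<open>i\<close> and \<open>j\<close> generate conjugate fields.
  In characteristic two this is impossible since one of these fields is separable and the other one
  is not.  Otherwise it allows to rescale \<open>i\<close> and \<open>j\<close> to square roots of \<open>-1\<close>, and the presence of
  such a square root in \<open>F(x i + y j)\<close> shows that \<open>x\<^sup>2 + y\<^sup>2\<close> is a square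
  (\<open>all_conjugate_imp_ordinary\<close>).
\<close>

section \<open>The centre and the Skolem--Noether theorem\<close>

context skew_field_with_centre
begin

lemma emb_zero: "emb 0 = 0"
  using emb_add[of 0 0] by simp

lemma emb_minus: "emb (- a) = - emb a"
  using emb_add[of a "- a"] by (simp add: emb_zero eq_neg_iff_add_eq_0 add.commute)

lemma emb_diff: "emb (a - b) = emb a - emb b"
  using emb_add[of a "- b"] by (simp add: emb_minus)

lemma emb_commute: "emb a * z = z * emb a"
  using range_emb by blast

lemma emb_eq_zero_iff: "emb a = 0 \<longleftrightarrow> a = 0"
proof
  assume "emb a = 0"
  show "a = 0"
  proof (rule ccontr)
    assume "a \<noteq> 0"
    then have "emb a * emb (inverse a) = 1"
      by (simp add: emb_one flip: emb_mult)
    with \<open>emb a = 0\<close> show False by simp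
  qed
qed (simp add: emb_zero)

lemma emb_eq_iff: "emb a = emb b \<longleftrightarrow> a = b"
  using emb_eq_zero_iff[of "a - b"] by (simp add: emb_diff)

lemma not_central_iff: "x \<notin> range emb \<longleftrightarrow> (\<exists>z. z * x \<noteq> x * z)"
  unfolding range_emb by fastforce

lemma span_one_insert: "z \<in> span {1, x} \<longleftrightarrow> (\<exists>a b. z = emb a + emb b * x)"
proof -
  have "z \<in> span {1, x} \<longleftrightarrow> (\<exists>a b. z - emb a * 1 - emb b * x = 0)"
    by (simp only: span_breakdown_eq span_empty singleton_iff)
  also have "\<dots> \<longleftrightarrow> (\<exists>a b. z = emb a + emb b * x)"
    by (simp add: algebra_simps)
  finally show ?thesis .
qed

lemma central_iff_span_one: "x \<in> range emb \<longleftrightarrow> x \<in> span {1}"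
  using span_breakdown_eq[of x 1 "{}"] by (auto simp: image_iff)

text \<open>
  This is the case of the Skolem--Noether theorem that is needed: for every \<open>z\<close> the element
  \<open>c = y z + z x - t z\<close> satisfies \<open>c x = y c\<close>.  If it vanished for all \<open>z\<close>, then \<open>z = 1\<close> would
  give \<open>x = t - y\<close>, and the remaining cases would say that \<open>y\<close> is central.
\<close>

lemma same_quadratic_equation_imp_conjugate:
  assumes x: "x * x = emb m + emb t * x" and y: "y * y = emb m + emb t * y"
    and nc: "y \<notin> range emb"
  shows "\<exists>c. c \<noteq> 0 \<and> c * x = y * c"
proof -
  define c where "c z = y * z + z * x - emb t * z" for z
  have eq: "c z * x = y * c z" for z
  proof -
    have 1: "z * x * x = emb m * z + emb t * (z * x)"
      by (simp add: mult.assoc x distrib_left)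
        (metis emb_commute mult.assoc)
    have 2: "y * (y * z) = emb m * z + emb t * (y * z)"
      by (simp only: y distrib_right mult.assoc[symmetric, of y y z])
        (simp add: mult.assoc)
    have 3: "y * (emb t * z) = emb t * (y * z)"
      by (metis emb_commute mult.assoc)
    have "c z * x = y * z * x + emb m * z"
      unfolding c_def by (simp add: left_diff_distrib distrib_right 1) (simp add: mult.assoc)
    also have "\<dots> = y * c z"
      unfolding c_def by (simp add: right_diff_distrib distrib_left 2 3) (simp add: mult.assoc)
    finally show ?thesis .
  qed
  show ?thesis
  proof (cases "\<forall>z. c z = 0")
    case True
    have x': "x = emb t - y"
      using spec[OF True, of 1] by (simp add: c_def algebra_simps)
    have "z * y = y * z" for z
      using spec[OF True, of z] by (simp add: c_def x' right_diff_distrib emb_commute)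
    with nc show ?thesis by (auto simp: not_central_iff)
  next
    case False
    with eq show ?thesis by blast
  qed
qed

end

section \<open>Maximal subfields\<close>

definition centralizer :: "'h::division_ring \<Rightarrow> 'h set" where
  "centralizer x = {z. z * x = x * z}"

definition conj_by :: "'h::division_ring \<Rightarrow> 'h set \<Rightarrow> 'h set" where
  "conj_by c K = (\<lambda>x. c * x * inverse c) ` K"

definition conjugate :: "'h::division_ring set \<Rightarrow> 'h set \<Rightarrow> bool" where
  "conjugate K L \<longleftrightarrow> (\<exists>c. c \<noteq> 0 \<and> L = conj_by c K)"

lemma conj_by_conj_by:
  fixes c d :: "'h::division_ring"
  assumes "c \<noteq> 0" and "d \<noteq> 0"
  shows "conj_by c (conj_by d K) = conj_by (c * d) K"
  using assms by (simp add: conj_by_def image_image nonzero_inverse_mult_distrib mult.assoc)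

lemma conj_by_one [simp]: "conj_by 1 K = K"
  by (simp add: conj_by_def)

lemma left_coset_eq_right_coset_conj_by:
  fixes c :: "'h::division_ring"
  assumes "c \<noteq> 0"
  shows "(*) c ` K = (\<lambda>x. x * c) ` conj_by c K"
  using assms by (simp add: conj_by_def image_image mult.assoc)

lemma inverse_mult_cancel:
  fixes c :: "'h::division_ring"
  assumes "c \<noteq> 0"
  shows "inverse c * (c * x) = x" and "c * (inverse c * x) = x"
  using assms by (simp_all flip: mult.assoc)

lemma intertwiner_iff_conj:
  fixes c :: "'h::division_ring"
  assumes "c \<noteq> 0"
  shows "c * x = y * c \<longleftrightarrow> y = c * x * inverse c"
proof
  assume "c * x = y * c"
  then show "y = c * x * inverse c"
    using assms by (simp add: mult.assoc)
next
  assume "y = c * x * inverse c"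
  then show "c * x = y * c"
    using assms by (simp add: mult.assoc)
qed

lemma conj_by_centralizer:
  fixes c :: "'h::division_ring"
  assumes "c \<noteq> 0"
  shows "conj_by c (centralizer x) = centralizer (c * x * inverse c)"
proof (intro equalityI subsetI)
  fix z assume "z \<in> conj_by c (centralizer x)"
  then obtain w where w: "w * x = x * w" and z: "z = c * w * inverse c"
    by (auto simp: conj_by_def centralizer_def)
  have "z * (c * x * inverse c) = c * (w * x) * inverse c"
    using assms by (simp add: z mult.assoc inverse_mult_cancel)
  also have "\<dots> = c * x * inverse c * z"
    using assms by (simp add: w) (simp add: z mult.assoc inverse_mult_cancel)
  finally show "z \<in> centralizer (c * x * inverse c)"
    by (simp add: centralizer_def)
next
  fix z assume "z \<in> centralizer (c * x * inverse c)"
  then have z: "z * (c * x * inverse c) = c * x * inverse c * z"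
    by (simp add: centralizer_def)
  have "inverse c * z * c * x = inverse c * (z * (c * x * inverse c)) * c"
    using assms by (simp add: mult.assoc)
  also have "\<dots> = x * (inverse c * z * c)"
    using assms by (simp add: z) (simp add: mult.assoc inverse_mult_cancel)
  finally have "inverse c * z * c \<in> centralizer x"
    by (simp add: centralizer_def)
  moreover have "z = c * (inverse c * z * c) * inverse c"
    using assms by (simp add: mult.assoc inverse_mult_cancel)
  ultimately show "z \<in> conj_by c (centralizer x)"
    unfolding conj_by_def by blast
qed

lemma diff_in_centralizer:
  "y \<in> centralizer x \<Longrightarrow> z \<in> centralizer x \<Longrightarrow> y - z \<in> centralizer x"
  by (simp add: centralizer_def algebra_simps)

lemma mult_in_centralizer:
  "y \<in> centralizer x \<Longrightarrow> z \<in> centralizer x \<Longrightarrow> y * z \<in> centralizer x"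
  unfolding centralizer_def mem_Collect_eq by (simp only: mult.assoc) (simp only: flip: mult.assoc)

lemma inverse_in_centralizer: "y \<in> centralizer x \<Longrightarrow> inverse y \<in> centralizer x"
  unfolding centralizer_def by (simp add: mult_commute_imp_mult_inverse_commute)

locale four_dimensional_skew_field = skew_field_with_centre emb
  for emb :: "'f::field \<Rightarrow> 'h::division_ring" +
  assumes dim_UNIV_4: "dim (UNIV :: 'h set) = 4"
begin

lemma independent_4_spans:
  assumes "independent B" and "card B = 4"
  shows "span B = UNIV"
proof -
  obtain C where C: "independent C" "UNIV \<subseteq> span C" "card C = 4"
    using basis_exists[of UNIV] dim_UNIV_4 by metis
  then have "finite C" by (simp add: card_ge_0_finite)
  interpret fd: finite_dimensional_vector_space "\<lambda>a x. emb a * x" C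
    using C \<open>finite C\<close> by unfold_locales auto
  show ?thesis
    using fd.card_ge_dim_independent[of B UNIV] assms dim_UNIV_4 by auto
qed

text \<open>
  If \<open>y\<close> commuted with \<open>x\<close> without lying in \<open>F + F x\<close>, then \<open>1, x, y\<close> would be linearly
  independent elements of the centralizer of \<open>x\<close>, and any \<open>z\<close> outside that centralizer would
  complete them to a basis of \<open>H\<close>.  Writing \<open>z x\<close> in this basis yields \<open>z (x - \<delta>) = w\<close>
  with \<open>\<delta> \<in> F\<close> and \<open>w\<close> commuting with \<open>x\<close>.  Hence \<open>z = w (x - \<delta>)\<inverse>\<close> commutes with \<open>x\<close> after all.
\<close>

lemma centralizer_eq_span:
  assumes x: "x \<notin> range emb"
  shows "centralizer x = span {1, x}"
proof (intro equalityI subsetI)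
  fix y assume "y \<in> span {1, x}"
  then obtain a b where "y = emb a + emb b * x" by (auto simp: span_one_insert)
  then show "y \<in> centralizer x"
    unfolding centralizer_def by (simp add: algebra_simps) (metis emb_commute mult.assoc)
next
  fix y assume y: "y \<in> centralizer x"
  show "y \<in> span {1, x}"
  proof (rule ccontr)
    assume ny: "y \<notin> span {1, x}"
    obtain z where z: "z \<notin> centralizer x"
      using x by (auto simp: centralizer_def not_central_iff)
    have sub: "subspace (centralizer x)"
      unfolding subspace_def centralizer_def
      by (auto simp: algebra_simps) (metis emb_commute mult.assoc)
    have V: "span {1, x, y} \<subseteq> centralizer x"
      by (rule span_minimal[OF _ sub]) (use y in \<open>auto simp: centralizer_def\<close>)
    have "independent {1}"
      by simp
    moreover have "x \<notin> span {1}"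
      using x by (simp add: central_iff_span_one)
    ultimately have "independent {1, x}"
      by (subst insert_commute) (rule independent_insertI)
    then have "independent {y, 1, x}"
      using ny by (rule independent_insertI[rotated])
    moreover have nz: "z \<notin> span {y, 1, x}"
      using z V by (auto simp: insert_commute)
    ultimately have "independent {z, y, 1, x}"
      by (rule independent_insertI[rotated])
    moreover have "card {z, y, 1, x} = 4"
    proof -
      have "x \<noteq> 1" using x emb_one by (metis rangeI)
      moreover have "y \<notin> {1, x}" using ny span_base[of y "{1, x}"] by fast
      moreover have "z \<notin> {y, 1, x}" using nz span_base[of z "{y, 1, x}"] by fast
      ultimately show ?thesis by auto
    qed
    ultimately have "z * x \<in> span {z, y, 1, x}"
      using independent_4_spans by blast
    then obtain d where d: "z * x - emb d * z \<in> span {y, 1, x}"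
      by (auto simp: span_breakdown_eq[of _ z])
    define w where "w = z * (x - emb d)"
    have w: "w \<in> centralizer x"
      using d V by (auto simp: w_def right_diff_distrib emb_commute insert_commute)
    have nz: "x - emb d \<noteq> 0"
      using x by auto
    have "x - emb d \<in> centralizer x"
      by (simp add: centralizer_def algebra_simps emb_commute)
    then have "w * inverse (x - emb d) \<in> centralizer x"
      by (intro mult_in_centralizer inverse_in_centralizer w)
    moreover have "w * inverse (x - emb d) = z"
      using nz by (simp add: w_def mult.assoc)
    ultimately show False using z by simp
  qed
qed

lemma mem_centralizer_iff:
  "x \<notin> range emb \<Longrightarrow> z \<in> centralizer x \<longleftrightarrow> (\<exists>a b. z = emb a + emb b * x)"
  by (simp add: centralizer_eq_span span_one_insert)

lemma quadratic_equation:
  assumes "x \<notin> range emb"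
  obtains m t where "x * x = emb m + emb t * x"
proof -
  have "x * x \<in> centralizer x" by (simp add: centralizer_def mult.assoc)
  then show thesis using that assms by (auto simp: mem_centralizer_iff)
qed

lemma emb_in_centralizer: "emb a \<in> centralizer x"
  by (simp add: centralizer_def emb_commute)

lemma commutative_subfield_centralizer:
  assumes "x \<notin> range emb"
  shows "commutative_subfield (centralizer x)"
proof -
  have "y * z = z * y" if y: "y \<in> centralizer x" and z: "z \<in> centralizer x" for y z
  proof -
    obtain a b where z: "z = emb a + emb b * x"
      using z mem_centralizer_iff[OF assms] by blast
    show ?thesis
      using y by (simp add: z centralizer_def distrib_left distrib_right emb_commute)
        (metis emb_commute mult.assoc)
  qed
  then show ?thesis
    unfolding commutative_subfield_def
    using diff_in_centralizer mult_in_centralizer inverse_in_centralizer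
      emb_in_centralizer[of 0] emb_in_centralizer[of 1]
    by (auto simp: emb_zero emb_one)
qed

lemma ex_noncentral: "\<exists>x. x \<notin> range emb"
proof (rule ccontr)
  assume "\<nexists>x. x \<notin> range emb"
  then have "span {1} = UNIV" by (auto simp: central_iff_span_one)
  then have "dim UNIV \<le> card {1::'h}" by (metis dim_le_card finite.emptyI finite.insertI subset_refl)
  then show False by (simp add: dim_UNIV_4)
qed

text \<open>
  Two commuting elements lie in each other's centralizer, so a commutative subfield that contains
  a noncentral \<open>x\<close> is contained in the centralizer of \<open>x\<close>, which is a commutative subfield itself.
\<close>

lemma maximal_subfield_centralizer:
  assumes "x \<notin> range emb"
  shows "maximal_subfield (centralizer x)"
  unfolding maximal_subfield_def
proof (intro conjI allI impI)
  fix L assume L: "commutative_subfield L \<and> centralizer x \<subseteq> L"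
  then have "x \<in> L" by (auto simp: centralizer_def)
  with L show "L = centralizer x"
    by (auto simp: centralizer_def commutative_subfield_def)
qed (rule commutative_subfield_centralizer[OF assms])

lemma maximal_subfield_eq_centralizer:
  assumes K: "maximal_subfield K" and "x \<in> K" and x: "x \<notin> range emb"
  shows "K = centralizer x"
proof -
  have "K \<subseteq> centralizer x"
    using assms by (auto simp: maximal_subfield_def commutative_subfield_def centralizer_def)
  with K commutative_subfield_centralizer[OF x] show ?thesis
    by (auto simp: maximal_subfield_def)
qed

lemma maximal_subfieldE:
  assumes "maximal_subfield K"
  obtains x where "x \<notin> range emb" "x \<in> K" "K = centralizer x"
proof (cases "K \<subseteq> range emb")
  case True
  obtain x where x: "x \<notin> range emb" using ex_noncentral by blast
  have "K \<subseteq> centralizer x" using True emb_in_centralizer by blast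
  then have "K = centralizer x"
    using assms commutative_subfield_centralizer[OF x] by (auto simp: maximal_subfield_def)
  with True x show thesis by (auto simp: centralizer_def)
next
  case False
  then obtain x where "x \<in> K" "x \<notin> range emb" by auto
  with assms that show thesis using maximal_subfield_eq_centralizer by blast
qed

lemma noncentral_conj:
  assumes "c \<noteq> 0" and "x \<notin> range emb"
  shows "c * x * inverse c \<notin> range emb"
proof
  assume "c * x * inverse c \<in> range emb"
  then obtain a where a: "c * x * inverse c = emb a" by auto
  then have "c * x = c * emb a"
    using assms(1) intertwiner_iff_conj[of c x "emb a"] by (simp add: emb_commute)
  with assms show False by simp
qed

lemma maximal_subfield_conj_by:
  fixes K :: "'h set"
  assumes "maximal_subfield K" and "c \<noteq> 0"
  shows "maximal_subfield (conj_by c K)"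
proof -
  obtain x where "x \<notin> range emb" and "K = centralizer x"
    using assms(1) by (rule maximal_subfieldE)
  with assms(2) show ?thesis
    by (simp add: conj_by_centralizer maximal_subfield_centralizer noncentral_conj)
qed

text \<open>
  A noncentral \<open>x \<in> K\<close> and its image under an \<open>F\<close>-isomorphism satisfy the same quadratic
  equation over \<open>F\<close>, hence are conjugate, and each of them generates its maximal subfield.
\<close>

lemma F_isomorphic_iff_conjugate:
  assumes K: "maximal_subfield K" and L: "maximal_subfield L"
  shows "F_isomorphic K L \<longleftrightarrow> conjugate K L"
  unfolding conjugate_def
proof
  assume "F_isomorphic K L"
  then obtain f where bij: "bij_betw f K L"
    and add: "\<And>x y. x \<in> K \<Longrightarrow> y \<in> K \<Longrightarrow> f (x + y) = f x + f y"
    and mult: "\<And>x y. x \<in> K \<Longrightarrow> y \<in> K \<Longrightarrow> f (x * y) = f x * f y"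
    and emb: "\<And>a. f (emb a) = emb a"
    by (auto simp: F_isomorphic_def)
  obtain x where x: "x \<notin> range emb" "x \<in> K" "K = centralizer x"
    using K by (rule maximal_subfieldE)
  have embK: "emb a \<in> K" for a
    using x emb_in_centralizer by blast
  obtain m t where eq: "x * x = emb m + emb t * x"
    using x(1) by (rule quadratic_equation)
  have "emb t * x \<in> K"
    using x embK mult_in_centralizer by blast
  then have eq': "f x * f x = emb m + emb t * f x"
    using arg_cong[OF eq, of f] x(2) embK by (simp add: add mult emb)
  have fx: "f x \<in> L"
    using bij x(2) by (auto simp: bij_betw_def)
  have nc: "f x \<notin> range emb"
  proof
    assume "f x \<in> range emb"
    then obtain a where "f x = f (emb a)" by (auto simp: emb)
    with bij x embK have "x = emb a" by (auto simp: bij_betw_def inj_on_def)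
    with x show False by auto
  qed
  obtain c where c: "c \<noteq> 0" "c * x = f x * c"
    using same_quadratic_equation_imp_conjugate[OF eq eq' nc] by blast
  have "L = centralizer (f x)"
    using maximal_subfield_eq_centralizer[OF L fx nc] .
  with c show "\<exists>c. c \<noteq> 0 \<and> L = conj_by c K"
    by (metis conj_by_centralizer intertwiner_iff_conj x(3))
next
  assume "\<exists>c. c \<noteq> 0 \<and> L = conj_by c K"
  then obtain c where c: "c \<noteq> 0" and L': "L = conj_by c K" by blast
  show "F_isomorphic K L"
    unfolding F_isomorphic_def
  proof (intro exI[of _ "\<lambda>x. c * x * inverse c"] conjI ballI allI)
    show "bij_betw (\<lambda>x. c * x * inverse c) K L"
      using c by (auto simp: bij_betw_def L' conj_by_def inj_on_def)
  next
    fix x y assume "x \<in> K" "y \<in> K"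
    show "c * (x + y) * inverse c = c * x * inverse c + c * y * inverse c"
      by (simp add: distrib_left distrib_right)
    show "c * (x * y) * inverse c = c * x * inverse c * (c * y * inverse c)"
      using c by (simp add: mult.assoc inverse_mult_cancel)
  next
    fix a
    show "c * emb a * inverse c = emb a"
      using c intertwiner_iff_conj[of c "emb a" "emb a"] by (simp add: emb_commute)
  qed
qed

end

section \<open>Cosets of maximal subfields\<close>

definition conj_closed :: "'h::division_ring set set \<Rightarrow> bool" where
  "conj_closed A \<longleftrightarrow> (\<forall>c K. c \<noteq> 0 \<longrightarrow> K \<in> A \<longrightarrow> conj_by c K \<in> A)"

lemma conj_closed_iff:
  fixes c :: "'h::division_ring"
  assumes "conj_closed A" and "c \<noteq> 0"
  shows "conj_by c K \<in> A \<longleftrightarrow> K \<in> A"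
proof
  assume "conj_by c K \<in> A"
  then have "conj_by (inverse c) (conj_by c K) \<in> A"
    using assms by (simp add: conj_closed_def)
  then show "K \<in> A"
    using assms(2) by (simp add: conj_by_conj_by)
qed (use assms in \<open>simp add: conj_closed_def\<close>)

lemma conjugate_refl: "conjugate K K"
  unfolding conjugate_def by (rule exI[of _ 1]) simp

lemma conj_closed_conjugates: "conj_closed {L. conjugate K L}"
  unfolding conj_closed_def conjugate_def
  by (auto simp: conj_by_conj_by) (metis mult_eq_0_iff)

text \<open>
  The left and the right direction of a line \<open>M\<close> are the lines through \<open>1\<close> that are left and right
  parallel to \<open>M\<close>.  Forming all quotients of elements of \<open>M\<close> avoids the choice of a point; on a line
  a single denominator already yields all of them.
\<close>

definition left_direction :: "'h::division_ring set \<Rightarrow> 'h set" where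
  "left_direction M = {inverse p * q | p q. p \<in> M \<and> p \<noteq> 0 \<and> q \<in> M}"

definition right_direction :: "'h::division_ring set \<Rightarrow> 'h set" where
  "right_direction M = {q * inverse p | p q. p \<in> M \<and> p \<noteq> 0 \<and> q \<in> M}"

text \<open>
  Membership in \<open>A\<close> decides which lines through \<open>1\<close> are to represent left parallel classes.
  The extreme cases \<open>A = UNIV\<close> and \<open>A = {}\<close> give back the left and the right direction.
\<close>

definition mixed_direction :: "'h::division_ring set set \<Rightarrow> 'h set \<Rightarrow> 'h set" where
  "mixed_direction A M = (if left_direction M \<in> A then left_direction M else right_direction M)"

lemma maximal_subfield_closed:
  assumes "maximal_subfield K"
  shows "1 \<in> K" and "x \<in> K \<Longrightarrow> y \<in> K \<Longrightarrow> x * y \<in> K" and "x \<in> K \<Longrightarrow> inverse x \<in> K"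
    and "x \<in> K \<Longrightarrow> y \<in> K \<Longrightarrow> x * y = y * x"
  using assms by (auto simp: maximal_subfield_def commutative_subfield_def)

lemma left_direction_coset:
  fixes K :: "'h::division_ring set"
  assumes K: "maximal_subfield K" and c: "c \<noteq> 0"
  shows "left_direction ((*) c ` K) = K"
proof (intro equalityI subsetI)
  fix z assume "z \<in> left_direction ((*) c ` K)"
  then obtain k l where "k \<in> K" "l \<in> K" "k \<noteq> 0" and z: "z = inverse (c * k) * (c * l)"
    by (auto simp: left_direction_def)
  then show "z \<in> K"
    using c maximal_subfield_closed[OF K]
    by (simp add: nonzero_inverse_mult_distrib mult.assoc inverse_mult_cancel)
next
  fix z assume "z \<in> K"
  moreover have "z = inverse (c * 1) * (c * z)"
    using c by (simp add: inverse_mult_cancel)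
  ultimately show "z \<in> left_direction ((*) c ` K)"
    using c maximal_subfield_closed(1)[OF K] unfolding left_direction_def
    by (intro CollectI exI[of _ "c * 1"] exI[of _ "c * z"]) auto
qed

lemma right_direction_coset:
  fixes K :: "'h::division_ring set"
  assumes K: "maximal_subfield K" and c: "c \<noteq> 0"
  shows "right_direction ((\<lambda>x. x * c) ` K) = K"
proof (intro equalityI subsetI)
  fix z assume "z \<in> right_direction ((\<lambda>x. x * c) ` K)"
  then obtain k l where "k \<in> K" "l \<in> K" "k \<noteq> 0" and z: "z = l * c * inverse (k * c)"
    by (auto simp: right_direction_def)
  then show "z \<in> K"
    using c maximal_subfield_closed[OF K]
    by (simp add: nonzero_inverse_mult_distrib mult.assoc inverse_mult_cancel)
next
  fix z assume "z \<in> K"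
  moreover have "z = z * c * inverse (1 * c)"
    using c by (simp add: mult.assoc)
  ultimately show "z \<in> right_direction ((\<lambda>x. x * c) ` K)"
    using c maximal_subfield_closed(1)[OF K] unfolding right_direction_def
    by (intro CollectI exI[of _ "1 * c"] exI[of _ "z * c"]) auto
qed

lemma coset_of_member:
  fixes K :: "'h::division_ring set"
  assumes K: "maximal_subfield K" and p: "p \<in> (*) c ` K" "p \<noteq> 0"
  shows "(*) c ` K = (*) p ` K"
proof -
  obtain k where k: "k \<in> K" "p = c * k" using p by auto
  have "(*) k ` K = K"
  proof (intro equalityI subsetI)
    fix z assume "z \<in> K"
    then have "inverse k * z \<in> K"
      using k maximal_subfield_closed[OF K] by blast
    moreover have "z = k * (inverse k * z)"
      using k p by (auto simp: inverse_mult_cancel)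
    ultimately show "z \<in> (*) k ` K" by blast
  qed (use k maximal_subfield_closed[OF K] in auto)
  then have "(*) c ` K = (*) c ` (*) k ` K" by simp
  also have "\<dots> = (*) p ` K" by (simp add: image_image k mult.assoc)
  finally show ?thesis .
qed

lemma right_coset_eq_left_coset_conj_by:
  fixes c :: "'h::division_ring"
  assumes "c \<noteq> 0"
  shows "(\<lambda>x. x * c) ` K = (*) c ` conj_by (inverse c) K"
  using assms left_coset_eq_right_coset_conj_by[OF assms, of "conj_by (inverse c) K"]
  by (simp add: conj_by_conj_by)

section \<open>Lines and parallelisms\<close>

context skew_field_with_centre
begin

definition mixed_parallel :: "'h set set \<Rightarrow> ('h set \<times> 'h set) set" where
  "mixed_parallel A =
     {(M, N). M \<in> lines \<and> N \<in> lines \<and> mixed_direction A M = mixed_direction A N}"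

lemma points_iff: "P \<in> points \<longleftrightarrow> (\<exists>p. p \<noteq> 0 \<and> P = span {p})"
proof
  assume P: "P \<in> points"
  then obtain B where B: "B \<subseteq> P" "independent B" "P \<subseteq> span B" "card B = 1"
    using basis_exists[of P] by (auto simp: points_def)
  then obtain p where p: "B = {p}" by (auto simp: card_1_singleton_iff)
  have "span B \<subseteq> P"
    using B P by (intro span_minimal) (auto simp: points_def)
  with B p show "\<exists>p. p \<noteq> 0 \<and> P = span {p}"
    by (intro exI[of _ p]) auto
next
  assume "\<exists>p. p \<noteq> 0 \<and> P = span {p}"
  then obtain p where "p \<noteq> 0" "P = span {p}" by blast
  moreover from this have "dim P = 1"
    using dim_span_eq_card_independent[of "{p}"] by simp
  ultimately show "P \<in> points"
    by (auto simp: points_def)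
qed

lemma span_singleton_subset_iff: "subspace M \<Longrightarrow> span {p} \<subseteq> M \<longleftrightarrow> p \<in> M"
  using span_minimal[of "{p}" M] span_base[of p "{p}"] by auto

text \<open>
  All parallelisms considered below assign a direction to each line and call lines parallel when
  their directions agree.
\<close>

lemma parallelism_kernel:
  assumes "\<And>M p. M \<in> lines \<Longrightarrow> p \<noteq> 0 \<Longrightarrow> \<exists>!N. N \<in> lines \<and> p \<in> N \<and> f N = f M"
  shows "parallelism {(M, N). M \<in> lines \<and> N \<in> lines \<and> f M = f N}"
proof -
  let ?R = "{(M, N). M \<in> lines \<and> N \<in> lines \<and> f M = f N}"
  have "equiv lines ?R"
    by (auto simp: equiv_def refl_on_def sym_def trans_def)
  moreover have "\<exists>!M. M \<in> C \<and> P \<subseteq> M" if P: "P \<in> points" and C: "C \<in> lines // ?R" for P C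
  proof -
    obtain p where p: "p \<noteq> 0" "P = span {p}"
      using P by (auto simp: points_iff)
    obtain M where M: "M \<in> lines" "C = ?R `` {M}"
      using C by (auto simp: quotient_def)
    have "N \<in> C \<and> P \<subseteq> N \<longleftrightarrow> N \<in> lines \<and> p \<in> N \<and> f N = f M" for N
      using M p span_singleton_subset_iff[of N p] by (auto simp: lines_def)
    then show ?thesis
      using assms[OF M(1) p(1)] by simp
  qed
  ultimately show ?thesis
    by (simp add: parallelism_def)
qed

text \<open>
  A class of a parallelism partitions the set of points, so it cannot be a proper subset of another
  such class.
\<close>

lemma parallelism_class_eqI:
  assumes R: "parallelism R" and S: "parallelism S" and M: "M \<in> lines"
    and sub: "R `` {M} \<subseteq> S `` {M}"
  shows "R `` {M} = S `` {M}"
proof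
  show "S `` {M} \<subseteq> R `` {M}"
  proof
    fix N assume N: "N \<in> S `` {M}"
    then have "N \<in> lines"
      using S by (auto simp: parallelism_def equiv_def refl_on_def)
    then have "subspace N" and "\<not> N \<subseteq> {0}"
      using dim_le_card[of N "{}"] by (auto simp: lines_def)
    then obtain p where p: "p \<noteq> 0" "p \<in> N" by auto
    then have P: "span {p} \<in> points" by (auto simp: points_iff)
    have unique: "\<exists>!N'. N' \<in> T `` {M} \<and> span {p} \<subseteq> N'" if "parallelism T" for T
    proof -
      have "\<forall>P\<in>points. \<forall>C\<in>lines // T. \<exists>!N'. N' \<in> C \<and> P \<subseteq> N'"
        using that by (simp add: parallelism_def)
      from bspec[OF bspec[OF this P] quotientI[OF M]] show ?thesis .
    qed
    from unique[OF R] obtain N' where N': "N' \<in> R `` {M}" "span {p} \<subseteq> N'"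
      by auto
    have "span {p} \<subseteq> N"
      using p \<open>subspace N\<close> by (simp add: span_singleton_subset_iff)
    moreover have "N' \<in> S `` {M}"
      using N' sub by blast
    ultimately have "N = N'"
      using N N'(2) Uniq_D[OF conjunct2[OF unique[OF S, unfolded ex1_iff_ex_Uniq]], of N N'] by simp
    with N' show "N \<in> R `` {M}" by simp
  qed
qed (rule sub)

end

context four_dimensional_skew_field
begin

lemma coset_eq_span:
  assumes x: "x \<notin> range emb"
  shows "(*) p ` centralizer x = span {p, p * x}"
proof -
  interpret mult: module_hom "\<lambda>a x. emb a * x" "\<lambda>a x. emb a * x" "(*) p"
  proof unfold_locales
    fix a z show "p * (emb a * z) = emb a * (p * z)"
      by (metis emb_commute mult.assoc)
  qed (simp add: distrib_left)
  show ?thesis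
    using mult.span_image[of "{1, x}"] by (simp add: centralizer_eq_span[OF x])
qed

text \<open>
  If \<open>u, v\<close> is a basis of \<open>M\<close>, then \<open>x = u\<inverse> v\<close> is noncentral and \<open>M = u (F + F x)\<close>.
\<close>

lemma lines_iff: "M \<in> lines \<longleftrightarrow> (\<exists>p K. p \<noteq> 0 \<and> maximal_subfield K \<and> M = (*) p ` K)"
proof
  assume M: "M \<in> lines"
  then obtain B where B: "B \<subseteq> M" "independent B" "M \<subseteq> span B" "card B = 2"
    using basis_exists[of M] by (auto simp: lines_def)
  then obtain u v where uv: "B = {v, u}" "u \<noteq> v" by (auto simp: card_2_iff)
  have "span B \<subseteq> M"
    using B M by (intro span_minimal) (auto simp: lines_def)
  then have M_eq: "M = span {u, v}"
    using B uv by (auto simp: insert_commute)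
  have u: "u \<noteq> 0" and v: "v \<notin> span {u}"
    using B(2) uv dependent_zero[of B] by (auto simp: independent_insert split: if_splits)
  define x where "x = inverse u * v"
  have v_eq: "v = u * x"
    using u by (simp add: x_def inverse_mult_cancel)
  have x: "x \<notin> range emb"
  proof
    assume "x \<in> range emb"
    then obtain a where "v = emb a * u"
      by (auto simp: v_eq emb_commute)
    then show False
      using v span_scale[OF span_base, of u "{u}" a] by simp
  qed
  have "M = (*) u ` centralizer x"
    by (simp add: coset_eq_span[OF x] M_eq v_eq)
  with u x show "\<exists>p K. p \<noteq> 0 \<and> maximal_subfield K \<and> M = (*) p ` K"
    using maximal_subfield_centralizer by blast
next
  assume "\<exists>p K. p \<noteq> 0 \<and> maximal_subfield K \<and> M = (*) p ` K"
  then obtain p K where p: "p \<noteq> 0" and K: "maximal_subfield K" and "M = (*) p ` K" by blast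
  moreover obtain x where x: "x \<notin> range emb" "K = centralizer x"
    using K by (rule maximal_subfieldE)
  ultimately have M: "M = span {p * x, p}"
    by (simp add: coset_eq_span insert_commute)
  have notin: "p * x \<notin> span {p}"
  proof
    assume "p * x \<in> span {p}"
    then obtain a where "p * x = emb a * p"
      by (auto simp: span_singleton)
    then have "p * x = p * emb a"
      by (simp add: emb_commute)
    with p x show False by auto
  qed
  then have "independent {p * x, p}"
    using p independent_insertI[OF notin] by simp
  moreover have "card {p * x, p} = 2"
  proof -
    have "p * x \<noteq> p" using notin span_base[of p "{p}"] by auto
    then show ?thesis by simp
  qed
  ultimately have "dim M = 2"
    unfolding M by (simp add: dim_eq_card_independent)
  then show "M \<in> lines"
    by (simp add: lines_def M)
qed

lemma ex_nonzero_on_line: "M \<in> lines \<Longrightarrow> \<exists>p\<in>M. p \<noteq> 0"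
  using maximal_subfield_closed(1) by (fastforce simp: lines_iff)

lemma left_coset_in_lines: "maximal_subfield K \<Longrightarrow> p \<noteq> 0 \<Longrightarrow> (*) p ` K \<in> lines"
  by (auto simp: lines_iff)

lemma right_coset_in_lines: "maximal_subfield K \<Longrightarrow> p \<noteq> 0 \<Longrightarrow> (\<lambda>x. x * p) ` K \<in> lines"
  by (auto simp: right_coset_eq_left_coset_conj_by maximal_subfield_conj_by left_coset_in_lines)

lemma line_eq_left_coset:
  assumes "M \<in> lines" and "p \<in> M" and "p \<noteq> 0"
  shows "M = (*) p ` left_direction M" and "maximal_subfield (left_direction M)"
proof -
  obtain c K where c: "c \<noteq> 0" and K: "maximal_subfield K" and M: "M = (*) c ` K"
    using assms(1) by (auto simp: lines_iff)
  have "left_direction M = K"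
    using M left_direction_coset[OF K c] by simp
  then show "M = (*) p ` left_direction M" and "maximal_subfield (left_direction M)"
    using M K assms coset_of_member[OF K] by auto
qed

text \<open>
  The statements about right cosets follow from \<open>p K = (p K p\<inverse>) p\<close>.  In particular, the two
  directions of a line are conjugate.
\<close>

lemma line_eq_right_coset:
  assumes "M \<in> lines" and "p \<in> M" and "p \<noteq> 0"
  shows "M = (\<lambda>x. x * p) ` right_direction M"
    and "right_direction M = conj_by p (left_direction M)"
    and "maximal_subfield (right_direction M)"
proof -
  note left = line_eq_left_coset[OF assms]
  have max: "maximal_subfield (conj_by p (left_direction M))"
    using left(2) assms(3) by (rule maximal_subfield_conj_by)
  have M: "M = (\<lambda>x. x * p) ` conj_by p (left_direction M)"
    using left(1) left_coset_eq_right_coset_conj_by[OF assms(3)] by simp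
  then show eq: "right_direction M = conj_by p (left_direction M)"
    using right_direction_coset[OF max assms(3)] by simp
  from M max show "M = (\<lambda>x. x * p) ` right_direction M" "maximal_subfield (right_direction M)"
    by (simp_all add: eq)
qed

lemma line_with_left_direction_iff:
  assumes K: "maximal_subfield K" and p: "p \<noteq> 0"
  shows "N \<in> lines \<and> p \<in> N \<and> left_direction N = K \<longleftrightarrow> N = (*) p ` K"
  using line_eq_left_coset[of N p] left_coset_in_lines[OF assms] left_direction_coset[OF assms] p
    maximal_subfield_closed(1)[OF K] by force

lemma line_with_right_direction_iff:
  assumes K: "maximal_subfield K" and p: "p \<noteq> 0"
  shows "N \<in> lines \<and> p \<in> N \<and> right_direction N = K \<longleftrightarrow> N = (\<lambda>x. x * p) ` K"
  using line_eq_right_coset[of N p] right_coset_in_lines[OF assms] right_direction_coset[OF assms] p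
    maximal_subfield_closed(1)[OF K] by force

lemma right_direction_in_iff:
  assumes "conj_closed A" and "M \<in> lines"
  shows "right_direction M \<in> A \<longleftrightarrow> left_direction M \<in> A"
  using ex_nonzero_on_line[OF assms(2)] line_eq_right_coset(2)[OF assms(2)] conj_closed_iff[OF assms(1)]
  by auto

lemma mixed_direction_in_iff:
  assumes "conj_closed A" and "M \<in> lines"
  shows "mixed_direction A M \<in> A \<longleftrightarrow> left_direction M \<in> A"
  using right_direction_in_iff[OF assms] by (simp add: mixed_direction_def)

lemma maximal_subfield_directions:
  assumes "M \<in> lines"
  shows "maximal_subfield (left_direction M)" and "maximal_subfield (right_direction M)"
    and "maximal_subfield (mixed_direction A M)"
  using ex_nonzero_on_line[OF assms] line_eq_left_coset(2)[OF assms] line_eq_right_coset(3)[OF assms]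
  by (auto simp: mixed_direction_def)

text \<open>
  Since the two directions of a line are conjugate, its mixed direction \<open>K\<close> tells whether the left
  or the right one has been chosen: the left one iff \<open>K \<in> A\<close>.  So the lines with mixed direction
  \<open>K\<close> are all the left cosets or all the right cosets of \<open>K\<close>, and through a point \<open>F p\<close> there
  is exactly one of them.
\<close>

lemma parallelism_mixed_parallel:
  assumes A: "conj_closed A"
  shows "parallelism (mixed_parallel A)"
  unfolding mixed_parallel_def
proof (rule parallelism_kernel)
  fix M p assume M: "M \<in> lines" and p: "p \<noteq> (0::'h)"
  define K where "K = mixed_direction A M"
  have K: "maximal_subfield K"
    using M by (simp add: K_def maximal_subfield_directions)
  show "\<exists>!N. N \<in> lines \<and> p \<in> N \<and> mixed_direction A N = mixed_direction A M"
    unfolding K_def[symmetric]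
  proof (cases "K \<in> A")
    case True
    have "N \<in> lines \<and> p \<in> N \<and> mixed_direction A N = K
        \<longleftrightarrow> N \<in> lines \<and> p \<in> N \<and> left_direction N = K" for N
      using True mixed_direction_in_iff[OF A, of N] by (auto simp: mixed_direction_def)
    then show "\<exists>!N. N \<in> lines \<and> p \<in> N \<and> mixed_direction A N = K"
      by (simp add: line_with_left_direction_iff[OF K p])
  next
    case False
    have "N \<in> lines \<and> p \<in> N \<and> mixed_direction A N = K
        \<longleftrightarrow> N \<in> lines \<and> p \<in> N \<and> right_direction N = K" for N
      using False mixed_direction_in_iff[OF A, of N] right_direction_in_iff[OF A, of N]
      by (auto simp: mixed_direction_def)
    then show "\<exists>!N. N \<in> lines \<and> p \<in> N \<and> mixed_direction A N = K"
      by (simp add: line_with_right_direction_iff[OF K p])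
  qed
qed

lemma left_parallel_eq: "left_parallel = mixed_parallel UNIV"
proof -
  have "(\<exists>c. c \<noteq> 0 \<and> (*) c ` M = N) \<longleftrightarrow> left_direction M = left_direction N"
    if M: "M \<in> lines" and N: "N \<in> lines" for M N
  proof
    assume "\<exists>c. c \<noteq> 0 \<and> (*) c ` M = N"
    then obtain c where c: "c \<noteq> 0" "N = (*) c ` M" by blast
    obtain p where p: "p \<in> M" "p \<noteq> 0" using ex_nonzero_on_line[OF M] by blast
    have "N = (*) c ` (*) p ` left_direction M"
      using c line_eq_left_coset(1)[OF M p] by simp
    also have "\<dots> = (*) (c * p) ` left_direction M"
      by (simp add: image_image mult.assoc)
    finally show "left_direction M = left_direction N"
      using c p M by (simp add: left_direction_coset maximal_subfield_directions)
  next
    assume eq: "left_direction M = left_direction N"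
    obtain p where p: "p \<in> M" "p \<noteq> 0" using ex_nonzero_on_line[OF M] by blast
    obtain q where q: "q \<in> N" "q \<noteq> 0" using ex_nonzero_on_line[OF N] by blast
    have "(*) (q * inverse p) ` M = (*) (q * inverse p) ` (*) p ` left_direction M"
      using line_eq_left_coset(1)[OF M p] by simp
    also have "\<dots> = (*) q ` left_direction N"
      using p by (simp add: image_image mult.assoc inverse_mult_cancel eq)
    also have "\<dots> = N"
      using line_eq_left_coset(1)[OF N q] by simp
    finally show "\<exists>c. c \<noteq> 0 \<and> (*) c ` M = N"
      using p q by (intro exI[of _ "q * inverse p"]) auto
  qed
  then show ?thesis
    by (simp add: left_parallel_def mixed_parallel_def mixed_direction_def cong: conj_cong)
qed

lemma right_parallel_eq: "right_parallel = mixed_parallel {}"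
proof -
  have "(\<exists>d. d \<noteq> 0 \<and> (\<lambda>x. x * d) ` M = N) \<longleftrightarrow> right_direction M = right_direction N"
    if M: "M \<in> lines" and N: "N \<in> lines" for M N
  proof
    assume "\<exists>d. d \<noteq> 0 \<and> (\<lambda>x. x * d) ` M = N"
    then obtain d where d: "d \<noteq> 0" "N = (\<lambda>x. x * d) ` M" by blast
    obtain p where p: "p \<in> M" "p \<noteq> 0" using ex_nonzero_on_line[OF M] by blast
    have "N = (\<lambda>x. x * d) ` (\<lambda>x. x * p) ` right_direction M"
      using d line_eq_right_coset(1)[OF M p] by simp
    also have "\<dots> = (\<lambda>x. x * (p * d)) ` right_direction M"
      by (simp add: image_image mult.assoc)
    finally show "right_direction M = right_direction N"
      using d p M by (simp add: right_direction_coset maximal_subfield_directions)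
  next
    assume eq: "right_direction M = right_direction N"
    obtain p where p: "p \<in> M" "p \<noteq> 0" using ex_nonzero_on_line[OF M] by blast
    obtain q where q: "q \<in> N" "q \<noteq> 0" using ex_nonzero_on_line[OF N] by blast
    have "(\<lambda>x. x * (inverse p * q)) ` M = (\<lambda>x. x * (inverse p * q)) ` (\<lambda>x. x * p) ` right_direction M"
      using line_eq_right_coset(1)[OF M p] by simp
    also have "\<dots> = (\<lambda>x. x * q) ` right_direction N"
      using p by (simp add: image_image mult.assoc inverse_mult_cancel eq)
    also have "\<dots> = N"
      using line_eq_right_coset(1)[OF N q] by simp
    finally show "\<exists>d. d \<noteq> 0 \<and> (\<lambda>x. x * d) ` M = N"
      using p q by (intro exI[of _ "inverse p * q"]) auto
  qed
  then show ?thesis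
    by (simp add: right_parallel_def mixed_parallel_def mixed_direction_def cong: conj_cong)
qed

lemma clifford_like_mixed_parallel:
  assumes A: "conj_closed A"
  shows "clifford_like (mixed_parallel A)"
proof -
  have "(M, N) \<in> mixed_parallel UNIV \<union> mixed_parallel {}" if "(M, N) \<in> mixed_parallel A" for M N
    using that mixed_direction_in_iff[OF A, of M] mixed_direction_in_iff[OF A, of N]
    by (auto simp: mixed_parallel_def mixed_direction_def split: if_splits)
  then show ?thesis
    using parallelism_mixed_parallel[OF A]
    by (auto simp: clifford_like_def left_parallel_eq right_parallel_eq)
qed

lemma conj_closed_UNIV: "conj_closed UNIV" and conj_closed_empty: "conj_closed {}"
  by (simp_all add: conj_closed_def)

text \<open>
  If every \<open>d\<close> normalized \<open>K\<close>, then for \<open>x \<in> K\<close> and \<open>y \<notin> K\<close> both \<open>y x = x' y\<close> and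
  \<open>(1 + y) x = x'' (1 + y)\<close> with \<open>x', x'' \<in> K\<close>.  As \<open>1\<close> and \<open>y\<close> are linearly independent
  over \<open>K\<close>, comparison gives \<open>x = x'' = x'\<close>.  So \<open>x\<close> would be central.
\<close>

lemma maximal_subfield_not_normal:
  fixes K :: "'h set"
  assumes K: "maximal_subfield K"
  shows "\<exists>d. d \<noteq> 0 \<and> conj_by d K \<noteq> K"
proof (rule ccontr)
  assume "\<nexists>d. d \<noteq> 0 \<and> conj_by d K \<noteq> K"
  then have norm: "\<exists>k\<in>K. d * x = k * d" if "d \<noteq> 0" "x \<in> K" for d x
    using that intertwiner_iff_conj[of d x] unfolding conj_by_def by (metis image_eqI)
  obtain x where x: "x \<notin> range emb" "x \<in> K" "K = centralizer x"
    using K by (rule maximal_subfieldE)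
  have "y * x = x * y" for y
  proof (cases "y \<in> K")
    case True
    with x(3) show ?thesis by (simp add: centralizer_def)
  next
    case False
    have "0 \<in> K" "1 \<in> K" by (simp_all add: x(3) centralizer_def)
    then have "- 1 \<in> K" by (simp add: x(3) centralizer_def)
    with False \<open>0 \<in> K\<close> have ny: "y \<noteq> 0" "1 + y \<noteq> 0"
      by (auto simp: add_eq_0_iff)
    obtain k where k: "k \<in> K" "y * x = k * y"
      using norm[OF ny(1) x(2)] by blast
    obtain l where l: "l \<in> K" "(1 + y) * x = l * (1 + y)"
      using norm[OF ny(2) x(2)] by blast
    have eq: "(k - l) * y = l - x"
      using k(2) l(2) by (simp add: algebra_simps)
    have "k = l"
    proof (rule ccontr)
      assume "k \<noteq> l"
      then have "y = inverse (k - l) * (l - x)"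
        by (simp add: inverse_mult_cancel flip: eq)
      moreover have "inverse (k - l) * (l - x) \<in> K"
        using k l x(2) unfolding x(3)
        by (intro mult_in_centralizer inverse_in_centralizer diff_in_centralizer)
      ultimately show False
        using False by simp
    qed
    with eq have "k = x" by simp
    with k show ?thesis by simp
  qed
  with x(1) show False by (auto simp: not_central_iff)
qed

text \<open>
  Each class of \<open>R\<close> is a full left or a full right parallel class.  Suppose that the class of
  \<open>M\<close> is a left one and the class of \<open>L\<close> a right one.  The left direction of \<open>M\<close> and the
  right direction of \<open>L\<close> are conjugate, so a suitable line \<open>N\<close> is a left coset of the former and a
  right coset of the latter.  It lies in both classes, which therefore coincide.
\<close>

lemma clifford_like_unique_if_conjugate:
  assumes conj: "\<And>K L :: 'h set. maximal_subfield K \<Longrightarrow> maximal_subfield L \<Longrightarrow> conjugate K L"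
    and R: "clifford_like R"
  shows "R = left_parallel \<or> R = right_parallel"
proof -
  have par: "parallelism R" and sub: "R \<subseteq> left_parallel \<union> right_parallel"
    using R by (auto simp: clifford_like_def)
  have left: "parallelism left_parallel" and right: "parallelism right_parallel"
    by (simp_all add: left_parallel_eq right_parallel_eq parallelism_mixed_parallel
        conj_closed_UNIV conj_closed_empty)
  have equivs: "equiv lines R" "equiv lines left_parallel" "equiv lines right_parallel"
    using par left right by (simp_all add: parallelism_def)
  have in_lines: "M \<in> lines \<and> N \<in> lines" if "(M, N) \<in> R \<union> left_parallel \<union> right_parallel" for M N
    using that sub by (auto simp: left_parallel_def right_parallel_def)
  \<comment> \<open>If \<open>N\<^sub>1\<close> is only right parallel and \<open>N\<^sub>2\<close> only left parallel to \<open>M\<close>, then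
    \<open>N\<^sub>1\<close> and \<open>N\<^sub>2\<close> are neither left nor right parallel to each other.\<close>
  have class_cases: "R `` {M} = left_parallel `` {M} \<or> R `` {M} = right_parallel `` {M}"
    if M: "M \<in> lines" for M
  proof -
    have "R `` {M} \<subseteq> left_parallel `` {M} \<or> R `` {M} \<subseteq> right_parallel `` {M}"
    proof (rule ccontr)
      assume "\<not> ?thesis"
      then obtain N\<^sub>1 N\<^sub>2 where N: "(M, N\<^sub>1) \<in> R" "(M, N\<^sub>1) \<notin> left_parallel"
          "(M, N\<^sub>2) \<in> R" "(M, N\<^sub>2) \<notin> right_parallel"
        by blast
      then have "(M, N\<^sub>1) \<in> right_parallel" "(M, N\<^sub>2) \<in> left_parallel"
        using sub by blast+
      moreover have "(N\<^sub>1, N\<^sub>2) \<in> R"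
        using N equivs(1) by (meson equivE symE transE)
      then have "(N\<^sub>1, N\<^sub>2) \<in> left_parallel \<or> (N\<^sub>1, N\<^sub>2) \<in> right_parallel"
        using sub by blast
      ultimately show False
        using N equivs(2,3) by (meson equivE symE transE)
    qed
    then show ?thesis
      using parallelism_class_eqI[OF par left M] parallelism_class_eqI[OF par right M] by blast
  qed
  have R_eqI: "R = S" if S: "S = left_parallel \<or> S = right_parallel"
    and classes: "\<And>M. M \<in> lines \<Longrightarrow> R `` {M} = S `` {M}" for S
  proof -
    have "(M, N) \<in> R \<longleftrightarrow> (M, N) \<in> S" for M N
      using classes[of M] S in_lines[of M N] by blast
    then show ?thesis by auto
  qed
  show ?thesis
  proof (cases "\<exists>M\<in>lines. R `` {M} = left_parallel `` {M}")
    case False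
    then show ?thesis
      using R_eqI[of right_parallel] class_cases by blast
  next
    case True
    then obtain M where M: "M \<in> lines" "R `` {M} = left_parallel `` {M}" by blast
    have "R `` {L} = left_parallel `` {L}" if L: "L \<in> lines" for L
    proof (cases "R `` {L} = left_parallel `` {L}")
      case False
      then have RL: "R `` {L} = right_parallel `` {L}"
        using class_cases[OF L] by blast
      obtain c where c: "c \<noteq> 0" "right_direction L = conj_by c (left_direction M)"
        using conj[of "left_direction M" "right_direction L"] M(1) L maximal_subfield_directions
        by (auto simp: conjugate_def)
      define N where "N = (*) c ` left_direction M"
      have N: "N \<in> lines" "left_direction N = left_direction M"
        using M(1) c by (simp_all add: N_def left_coset_in_lines left_direction_coset
            maximal_subfield_directions)
      have "N = (\<lambda>x. x * c) ` right_direction L"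
        using c left_coset_eq_right_coset_conj_by[OF c(1)] by (simp add: N_def)
      then have "right_direction N = right_direction L"
        using L c(1) by (simp add: right_direction_coset maximal_subfield_directions)
      with N M(1) L have "(M, N) \<in> left_parallel" "(L, N) \<in> right_parallel"
        by (simp_all add: left_parallel_eq right_parallel_eq mixed_parallel_def mixed_direction_def)
      with M(2) RL have "(M, N) \<in> R" "(L, N) \<in> R" by blast+
      then have "(M, L) \<in> R"
        using equivs(1) by (meson equivE symE transE)
      then have "(M, L) \<in> left_parallel" using M(2) by blast
      with \<open>(M, L) \<in> R\<close> M(2) show ?thesis
        using equivs(1,2) by (metis equiv_class_eq)
    qed
    then show ?thesis
      using R_eqI[of left_parallel] by blast
  qed
qed

text \<open>
  Take for \<open>A\<close> the conjugacy class of \<open>K\<close>.  The mixed parallelism then has the left cosets of \<open>K\<close>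
  and the right cosets of \<open>L\<close> as classes.  For neither field are these also cosets of the other
  side, because no maximal subfield is normalized by all of \<open>H\<close>.
\<close>

lemma ex_other_clifford_like:
  fixes K L :: "'h set"
  assumes K: "maximal_subfield K" and L: "maximal_subfield L" and nc: "\<not> conjugate K L"
  shows "\<exists>R. clifford_like R \<and> R \<noteq> left_parallel \<and> R \<noteq> right_parallel"
proof -
  define A where "A = {L. conjugate K L}"
  have A: "conj_closed A"
    by (simp add: A_def conj_closed_conjugates)
  have KA: "K \<in> A" and LA: "L \<notin> A"
    using nc by (simp_all add: A_def conjugate_refl)
  have line: "J \<in> lines" "left_direction J = J" "right_direction J = J" if J: "maximal_subfield J" for J
    using left_coset_in_lines[OF J, of 1] left_direction_coset[OF J, of 1]
      right_direction_coset[OF J, of 1]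
    by simp_all
  obtain c where c: "c \<noteq> 0" "conj_by c L \<noteq> L"
    using maximal_subfield_not_normal[OF L] by blast
  have cL: "(*) c ` L \<in> lines" "left_direction ((*) c ` L) = L"
    using c L by (simp_all add: left_coset_in_lines left_direction_coset)
  have "c \<in> (*) c ` L"
    using maximal_subfield_closed(1)[OF L] by force
  then have cL': "right_direction ((*) c ` L) = conj_by c L"
    using line_eq_right_coset(2)[OF cL(1) _ c(1)] by (simp add: cL(2))
  have "(L, (*) c ` L) \<in> left_parallel" "(L, (*) c ` L) \<notin> mixed_parallel A"
    using cL cL' c line[OF L] LA
    by (simp_all add: left_parallel_eq mixed_parallel_def mixed_direction_def)
  then have "mixed_parallel A \<noteq> left_parallel" by blast
  moreover
  obtain d where d: "d \<noteq> 0" "conj_by d K \<noteq> K"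
    using maximal_subfield_not_normal[OF K] by blast
  define N where "N = (*) d ` K"
  have N: "N \<in> lines" "left_direction N = K"
    using d K by (simp_all add: N_def left_coset_in_lines left_direction_coset)
  have "d \<in> N"
    using maximal_subfield_closed(1)[OF K] by (force simp: N_def)
  then have N': "right_direction N = conj_by d K"
    using line_eq_right_coset(2)[OF N(1) _ d(1)] by (simp add: N(2))
  have "(K, N) \<in> mixed_parallel A" "(K, N) \<notin> right_parallel"
    using N N' d line[OF K] KA
    by (simp_all add: right_parallel_eq mixed_parallel_def mixed_direction_def)
  then have "mixed_parallel A \<noteq> right_parallel" by blast
  ultimately show ?thesis
    using clifford_like_mixed_parallel[OF A] by blast
qed

theorem all_conjugate_iff_only_clifford_parallelisms:
  "(\<forall>K L :: 'h set. maximal_subfield K \<and> maximal_subfield L \<longrightarrow> conjugate K L) \<longleftrightarrow>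
   {R. clifford_like R} = {left_parallel, right_parallel}"
proof
  assume "\<forall>K L :: 'h set. maximal_subfield K \<and> maximal_subfield L \<longrightarrow> conjugate K L"
  then show "{R. clifford_like R} = {left_parallel, right_parallel}"
    using clifford_like_unique_if_conjugate clifford_like_mixed_parallel conj_closed_UNIV
      conj_closed_empty left_parallel_eq right_parallel_eq by auto
next
  assume "{R. clifford_like R} = {left_parallel, right_parallel}"
  then show "\<forall>K L :: 'h set. maximal_subfield K \<and> maximal_subfield L \<longrightarrow> conjugate K L"
    using ex_other_clifford_like by blast
qed

end

section \<open>The ordinary quaternion skew field\<close>

lemma ordinary_quaternion_matrix_mult:
  "ordinary_quaternion_matrix a1 a2 b1 b2 ** ordinary_quaternion_matrix c1 c2 d1 d2 =
   ordinary_quaternion_matrix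
     (a1 * c1 - a2 * c2 - b1 * d1 - b2 * d2) (a1 * c2 + a2 * c1 + b1 * d2 - b2 * d1)
     (a1 * d1 - a2 * d2 + b1 * c1 + b2 * c2) (a1 * d2 + a2 * d1 - b1 * c2 + b2 * c1)"
  by (simp add: ordinary_quaternion_matrix_def matrix_matrix_mult_def vec_eq_iff forall_2
      sum_2 times_adjoin_i_def plus_adjoin_i_def algebra_simps)

lemma ordinary_quaternion_matrix_add:
  "ordinary_quaternion_matrix a1 a2 b1 b2 + ordinary_quaternion_matrix c1 c2 d1 d2 =
   ordinary_quaternion_matrix (a1 + c1) (a2 + c2) (b1 + d1) (b2 + d2)"
  by (simp add: ordinary_quaternion_matrix_def vec_eq_iff forall_2 plus_adjoin_i_def)

lemma ordinary_quaternion_matrix_eq_iff: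
  "ordinary_quaternion_matrix a1 a2 b1 b2 = ordinary_quaternion_matrix c1 c2 d1 d2 \<longleftrightarrow>
   a1 = c1 \<and> a2 = c2 \<and> b1 = d1 \<and> b2 = d2"
  by (auto simp: ordinary_quaternion_matrix_def vec_eq_iff forall_2)

lemma mat_eq_ordinary_quaternion_matrix:
  "mat (Adj a 0) = ordinary_quaternion_matrix a 0 0 0"
  by (simp add: ordinary_quaternion_matrix_def vec_eq_iff forall_2 mat_def zero_adjoin_i_def)

context four_dimensional_skew_field
begin

lemma scaled_mult_scaled: "(emb r * x) * (emb s * y) = emb (r * s) * (x * y)"
proof -
  have "x * (emb s * y) = emb s * (x * y)"
    by (metis emb_commute mult.assoc)
  then show ?thesis
    by (simp add: mult.assoc)
qed

lemma neq_uminus_self: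
  fixes z :: 'h
  assumes "(2::'f) \<noteq> 0" and "z \<noteq> 0"
  shows "z \<noteq> - z"
proof
  assume "z = - z"
  then have "z + z = 0" by (simp add: eq_neg_iff_add_eq_0)
  moreover have "emb 2 = 2"
    using emb_add[of 1 1] by (simp add: emb_one)
  then have "(2::'h) \<noteq> 0"
    using assms(1) emb_eq_zero_iff[of 2] by simp
  ultimately show False
    using assms(2) by (simp flip: mult_2)
qed

text \<open>
  Subtracting the scalar part of a noncentral element of \<open>K\<close> leaves \<open>y = b i + c j + d i j\<close> with
  \<open>y\<^sup>2 = - (b\<^sup>2 + c\<^sup>2 + d\<^sup>2)\<close>, and in a Pythagorean field this is \<open>- s\<^sup>2\<close> for some \<open>s\<close>.
\<close>

lemma minus_one_square_if_ordinary:
  fixes K :: "'h set"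
  assumes pyth: "pythagorean TYPE('f)" and ord: is_ordinary_quaternion_skew_field
    and K: "maximal_subfield K"
  shows "\<exists>s\<in>K. s * s = - 1"
proof -
  obtain f :: "'h \<Rightarrow> 'f adjoin_i^2^2" where bij: "bij_betw f UNIV ordinary_quaternion_algebra"
    and add: "\<And>x y. f (x + y) = f x + f y" and mult: "\<And>x y. f (x * y) = f x ** f y"
    and emb: "\<And>a. f (emb a) = mat (Adj a 0)"
    using ord by (auto simp: is_ordinary_quaternion_skew_field_def)
  obtain x where x: "x \<notin> range emb" "K = centralizer x"
    using K by (rule maximal_subfieldE)
  have "f x \<in> ordinary_quaternion_algebra"
    using bij by (auto simp: bij_betw_def)
  then obtain a b c d where fx: "f x = ordinary_quaternion_matrix a b c d"
    by (auto simp: ordinary_quaternion_algebra_def)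
  define y where "y = x - emb a"
  have y: "y \<in> K" "y \<noteq> 0"
    using x by (auto simp: y_def centralizer_def algebra_simps emb_commute)
  have "f y = ordinary_quaternion_matrix 0 b c d"
  proof -
    have "f y + ordinary_quaternion_matrix a 0 0 0 = f x"
      using add[of y "emb a"] by (simp add: y_def emb mat_eq_ordinary_quaternion_matrix)
    also have "\<dots> = ordinary_quaternion_matrix 0 b c d + ordinary_quaternion_matrix a 0 0 0"
      by (simp add: fx ordinary_quaternion_matrix_add)
    finally show ?thesis by simp
  qed
  then have "f (y * y) = f (emb (- (b\<^sup>2 + c\<^sup>2 + d\<^sup>2)))"
    by (simp add: mult emb mat_eq_ordinary_quaternion_matrix ordinary_quaternion_matrix_mult
        ordinary_quaternion_matrix_eq_iff power2_eq_square)
  then have yy: "y * y = - emb (b\<^sup>2 + c\<^sup>2 + d\<^sup>2)"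
    using bij by (simp add: bij_betw_def inj_eq flip: emb_minus)
  obtain r where "b\<^sup>2 + c\<^sup>2 = r\<^sup>2"
    using pyth by (auto simp: pythagorean_def)
  moreover obtain s where "r\<^sup>2 + d\<^sup>2 = s\<^sup>2"
    using pyth unfolding pythagorean_def by blast
  ultimately have ys: "y * y = - emb (s * s)"
    using yy by (simp add: power2_eq_square)
  with y have s: "s \<noteq> 0"
    by (auto simp: emb_zero)
  have "(emb (1 / s) * y) * (emb (1 / s) * y) = emb (1 / s * (1 / s)) * (y * y)"
    by (rule scaled_mult_scaled)
  also have "\<dots> = - 1"
    using s by (simp add: ys emb_one flip: emb_mult)
  finally show ?thesis
    using y x mult_in_centralizer emb_in_centralizer by blast
qed

lemma conjugate_if_same_square:
  assumes K: "maximal_subfield K" and L: "maximal_subfield L"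
    and x: "x \<in> K" "x \<notin> range emb" and y: "y \<in> L" "y \<notin> range emb"
    and xx: "x * x = emb a" and yy: "y * y = emb a"
  shows "conjugate K L"
proof -
  obtain c where c: "c \<noteq> 0" "c * x = y * c"
    using same_quadratic_equation_imp_conjugate[of x a 0 y] xx yy y by (auto simp: emb_zero)
  then have "y = c * x * inverse c"
    by (simp add: intertwiner_iff_conj)
  then have "L = conj_by c K"
    using c maximal_subfield_eq_centralizer[OF K x] maximal_subfield_eq_centralizer[OF L y]
    by (simp add: conj_by_centralizer)
  with c show ?thesis
    by (auto simp: conjugate_def)
qed

lemma square_root_in_conjugate:
  assumes "conjugate K L" and x: "x \<in> K" "x \<notin> range emb" "x * x = emb a"
  shows "\<exists>y\<in>L. y \<notin> range emb \<and> y * y = emb a"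
proof -
  obtain c where c: "c \<noteq> 0" "L = conj_by c K"
    using assms(1) by (auto simp: conjugate_def)
  have "c * x * inverse c * (c * x * inverse c) = c * (x * x) * inverse c"
    using c by (simp add: mult.assoc inverse_mult_cancel)
  also have "\<dots> = emb a"
    using c intertwiner_iff_conj[of c "emb a" "emb a"] by (simp add: x emb_commute)
  finally show ?thesis
    using c x noncentral_conj[of c x] by (intro bexI[of _ "c * x * inverse c"]) (auto simp: conj_by_def)
qed

theorem ordinary_imp_conjugate:
  fixes K L :: "'h set"
  assumes real: "formally_real TYPE('f)" and pyth: "pythagorean TYPE('f)"
    and ord: is_ordinary_quaternion_skew_field
    and K: "maximal_subfield K" and L: "maximal_subfield L"
  shows "conjugate K L"
proof -
  obtain s t where s: "s \<in> K" "s * s = - 1" and t: "t \<in> L" "t * t = - 1"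
    using minus_one_square_if_ordinary[OF pyth ord K] minus_one_square_if_ordinary[OF pyth ord L]
    by auto
  have "z \<notin> range emb" if "z * z = - 1" for z
  proof
    assume "z \<in> range emb"
    then obtain a where "z = emb a" by auto
    with that have "emb (a\<^sup>2) = emb (- 1)"
      by (simp add: emb_mult emb_minus emb_one power2_eq_square)
    with real show False
      by (auto simp: emb_eq_iff formally_real_def)
  qed
  with s t show ?thesis
    using conjugate_if_same_square[OF K L s(1) _ t(1), of "- 1"] by (simp add: emb_minus emb_one)
qed

lemma square_of_linear_combination:
  assumes "x * x = emb a + emb t * x"
  shows "(emb u + emb v * x) * (emb u + emb v * x)
    = emb (u * u + v * v * a) + emb (2 * u * v + v * v * t) * x"
proof -
  have comm: "x * emb r = emb r * x" "x * (emb r * z) = emb r * (x * z)" for r z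
    by (metis emb_commute mult.assoc)+
  have double: "emb (2 * (u * v)) = emb (u * v) + emb (v * u)"
    by (simp flip: emb_add)
  show ?thesis
    by (simp add: distrib_left distrib_right mult.assoc comm assms emb_add double flip: emb_mult)
qed

lemma central_combination_iff:
  assumes "x \<notin> range emb"
  shows "emb a + emb b * x \<in> range emb \<longleftrightarrow> b = 0"
proof
  assume "emb a + emb b * x \<in> range emb"
  then obtain c where "emb b * x = emb (c - a)"
    by (auto simp: emb_diff algebra_simps)
  show "b = 0"
  proof (rule ccontr)
    assume b: "b \<noteq> 0"
    then have "x = emb (inverse b) * (emb b * x)"
      by (simp add: emb_one flip: emb_mult mult.assoc)
    also have "\<dots> = emb (inverse b * (c - a))"
      by (simp add: \<open>emb b * x = emb (c - a)\<close> emb_mult)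
    finally show False using assms by blast
  qed
qed (simp add: emb_zero)

text \<open>
  Squaring \<open>u + v x\<close> produces the term \<open>2 u v x\<close>, so for \<open>2 \<noteq> 0\<close> a square that lies in the
  centre forces \<open>u = 0\<close> or \<open>v = 0\<close>.
\<close>

lemma central_square_in_centralizer:
  assumes two: "(2::'f) \<noteq> 0" and x: "x \<notin> range emb" "x * x = emb a"
    and y: "y \<in> centralizer x" "y \<notin> range emb" "y * y = emb b"
  obtains v where "v \<noteq> 0" "y = emb v * x" "v * v * a = b"
proof -
  obtain u v where uv: "y = emb u + emb v * x"
    using y(1) x(1) by (auto simp: mem_centralizer_iff)
  have v: "v \<noteq> 0"
    using y(2) by (auto simp: uv emb_zero)
  have sq: "emb (u * u + v * v * a) + emb (2 * u * v) * x = emb b"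
    using square_of_linear_combination[of x a 0 u v] x(2) y(3) by (simp add: uv emb_zero)
  then have "emb (u * u + v * v * a) + emb (2 * u * v) * x \<in> range emb" by simp
  then have "2 * u * v = 0"
    by (simp only: central_combination_iff[OF x(1)])
  with two v have "u = 0" by simp
  with v uv sq show thesis
    using that[of v] by (simp add: emb_zero emb_eq_iff)
qed

text \<open>
  In characteristic two \<open>F(i)\<close> is separable over \<open>F\<close> whereas \<open>F(j)\<close> is inseparable: all
  squares of elements of \<open>F(j)\<close> are central, but the only elements of \<open>F(i)\<close> with this property
  are those of \<open>F\<close>.
\<close>

lemma char_2_not_all_conjugate:
  assumes two: "(2::'f) = 0" and b: "b \<noteq> 0"
    and i: "i * i + i = emb a" and j: "j * j = emb b" and ji: "j * i = (i + 1) * j"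
  shows "\<exists>K L :: 'h set. maximal_subfield K \<and> maximal_subfield L \<and> \<not> conjugate K L"
proof -
  have "j \<noteq> 0"
    using j b by (auto simp: emb_eq_zero_iff[symmetric])
  then have "j * i \<noteq> i * j"
    by (simp add: ji distrib_right)
  then have nc: "i \<notin> range emb" "j \<notin> range emb"
    unfolding not_central_iff by metis+
  have "\<not> conjugate (centralizer j) (centralizer i)"
  proof
    assume "conjugate (centralizer j) (centralizer i)"
    then obtain y where y: "y \<in> centralizer i" "y \<notin> range emb" "y * y = emb b"
      using square_root_in_conjugate[of "centralizer j" "centralizer i" j b] j nc(2)
      by (auto simp: centralizer_def)
    obtain u v where uv: "y = emb u + emb v * i"
      using y(1) nc(1) by (auto simp: mem_centralizer_iff)
    have "i * i = emb a + emb (- 1) * i"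
      using i by (simp add: emb_minus emb_one algebra_simps)
    from square_of_linear_combination[OF this, of u v]
    have "emb (u * u + v * v * a) + emb (- (v * v)) * i \<in> range emb"
      using y(3) by (simp add: uv two)
    then have "v = 0"
      by (simp only: central_combination_iff[OF nc(1)]) simp
    with y(2) uv show False by (simp add: emb_zero)
  qed
  moreover have "maximal_subfield (centralizer i)" "maximal_subfield (centralizer j)"
    using nc by (simp_all add: maximal_subfield_centralizer)
  ultimately show ?thesis
    by auto
qed

text \<open>
  The coordinates are ordered like the parameters of \<open>ordinary_quaternion_matrix\<close>, so that for
  anticommuting square roots \<open>i\<close> and \<open>j\<close> of \<open>-1\<close> both satisfy the same product formula.
\<close>

definition quaternion :: "'h \<Rightarrow> 'h \<Rightarrow> 'f \<Rightarrow> 'f \<Rightarrow> 'f \<Rightarrow> 'f \<Rightarrow> 'h" where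
  "quaternion i j a b c d = emb a + emb b * i + emb c * j + emb d * (i * j)"

lemma quaternion_add:
  "quaternion i j a1 a2 b1 b2 + quaternion i j c1 c2 d1 d2 =
   quaternion i j (a1 + c1) (a2 + c2) (b1 + d1) (b2 + d2)"
  by (simp add: quaternion_def emb_add algebra_simps)

lemma quaternion_mult:
  assumes ii: "i * i = - 1" and jj: "j * j = - 1" and ji: "j * i = - (i * j)"
  shows "quaternion i j a1 a2 b1 b2 * quaternion i j c1 c2 d1 d2 =
   quaternion i j
     (a1 * c1 - a2 * c2 - b1 * d1 - b2 * d2) (a1 * c2 + a2 * c1 + b1 * d2 - b2 * d1)
     (a1 * d1 - a2 * d2 + b1 * c1 + b2 * c2) (a1 * d2 + a2 * d1 - b1 * c2 + b2 * c1)"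
proof -
  have comm: "i * (emb r * z) = emb r * (i * z)" "j * (emb r * z) = emb r * (j * z)"
    "i * emb r = emb r * i" "j * emb r = emb r * j" for r z
    by (metis emb_commute mult.assoc)+
  have assoc: "i * (i * z) = - z" "j * (j * z) = - z" "j * (i * z) = - (i * (j * z))" for z
    using ii jj ji by (simp_all flip: mult.assoc)
  show ?thesis
    unfolding quaternion_def
    by (simp add: distrib_left distrib_right mult.assoc comm)
      (simp add: ii jj ji assoc emb_add emb_diff distrib_left distrib_right left_diff_distrib
        right_diff_distrib flip: emb_mult)
qed

lemma quaternion_coordinates:
  assumes ii: "i * i = - 1" and jj: "j * j = - 1" and ji: "j * i = - (i * j)"
    and two: "(2::'f) \<noteq> 0" and span: "span {1, i, j, i * j} = UNIV"
  shows "quaternion i j a b c d = quaternion i j a' b' c' d' \<longleftrightarrow> a = a' \<and> b = b' \<and> c = c' \<and> d = d'"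
    and "\<exists>a b c d. z = quaternion i j a b c d"
proof -
  have ne: "i * j \<noteq> j * i"
  proof
    assume "i * j = j * i"
    then have "i * j = 0"
      using ji neq_uminus_self[OF two, of "i * j"] by auto
    with ii jj show False by auto
  qed
  then have i: "i \<notin> range emb"
    unfolding not_central_iff by metis
  \<comment> \<open>A relation \<open>(a + b i) + (c + d i) j = 0\<close> with \<open>c + d i \<noteq> 0\<close> would put \<open>j\<close> into \<open>F(i)\<close>.\<close>
  have zero: "a = 0 \<and> b = 0 \<and> c = 0 \<and> d = 0" if "quaternion i j a b c d = 0" for a b c d
  proof -
    have eq: "(emb c + emb d * i) * j = - (emb a + emb b * i)"
      using that by (simp add: quaternion_def algebra_simps add_eq_0_iff)
    have zero_iff: "emb r + emb s * i = 0 \<longleftrightarrow> r = 0 \<and> s = 0" for r s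
    proof
      assume 0: "emb r + emb s * i = 0"
      then have "emb r + emb s * i \<in> range emb" using emb_zero by (metis rangeI)
      then have "s = 0" by (simp add: central_combination_iff[OF i])
      with 0 show "r = 0 \<and> s = 0" by (simp add: emb_zero emb_eq_zero_iff)
    qed (simp add: emb_zero)
    have "emb c + emb d * i = 0"
    proof (rule ccontr)
      assume "emb c + emb d * i \<noteq> 0"
      then have "inverse (emb c + emb d * i) * ((emb c + emb d * i) * j) = j"
        by (rule inverse_mult_cancel)
      then have j: "j = inverse (emb c + emb d * i) * - (emb a + emb b * i)"
        by (simp only: eq)
      have C: "emb r + emb s * i \<in> centralizer i" for r s
        using i by (auto simp: mem_centralizer_iff)
      have "j = inverse (emb c + emb d * i) * (emb (- a) + emb (- b) * i)"
        using j by (simp add: emb_minus)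
      then have "j \<in> centralizer i"
        using C mult_in_centralizer inverse_in_centralizer by metis
      with ne show False by (simp add: centralizer_def)
    qed
    moreover from this and eq have "- (emb a + emb b * i) = 0"
      by (simp only: mult_zero_left)
    then have "emb a + emb b * i = 0"
      by (simp only: neg_equal_0_iff_equal)
    ultimately show ?thesis
      by (simp only: zero_iff)
  qed
  show "quaternion i j a b c d = quaternion i j a' b' c' d'
      \<longleftrightarrow> a = a' \<and> b = b' \<and> c = c' \<and> d = d'"
  proof
    assume "quaternion i j a b c d = quaternion i j a' b' c' d'"
    then have "quaternion i j (a - a') (b - b') (c - c') (d - d') = 0"
      by (simp add: quaternion_def emb_diff algebra_simps)
    then show "a = a' \<and> b = b' \<and> c = c' \<and> d = d'"
      using zero by force
  qed simp
  have "z \<in> span {i * j, j, i, 1}"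
    using span by (simp add: insert_commute)
  then obtain a b c d where "z - emb d * (i * j) - emb c * j - emb b * i - emb a * 1 = 0"
    by (simp only: span_breakdown_eq span_empty singleton_iff) blast
  then have "z = quaternion i j a b c d"
    by (simp add: quaternion_def algebra_simps)
  then show "\<exists>a b c d. z = quaternion i j a b c d" by blast
qed

lemma ordinary_if_standard_basis:
  assumes ii: "i * i = - 1" and jj: "j * j = - 1" and ji: "j * i = - (i * j)"
    and two: "(2::'f) \<noteq> 0" and span: "span {1, i, j, i * j} = UNIV"
  shows is_ordinary_quaternion_skew_field
proof -
  note eq_iff = quaternion_coordinates(1)[OF assms] and ex = quaternion_coordinates(2)[OF assms]
  define f where "f z = (THE m. \<forall>a b c d. z = quaternion i j a b c d \<longrightarrow>
    m = ordinary_quaternion_matrix a b c d)" for z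
  have f: "f (quaternion i j a b c d) = ordinary_quaternion_matrix a b c d" for a b c d
    unfolding f_def by (rule the_equality) (auto simp: eq_iff)
  have "bij_betw f UNIV ordinary_quaternion_algebra"
    unfolding bij_betw_def
  proof
    show "inj f"
    proof (rule injI)
      fix x y assume "f x = f y"
      moreover obtain a b c d where "x = quaternion i j a b c d" using ex by blast
      moreover obtain a' b' c' d' where "y = quaternion i j a' b' c' d'" using ex by blast
      ultimately show "x = y"
        by (simp add: f ordinary_quaternion_matrix_eq_iff)
    qed
    show "range f = ordinary_quaternion_algebra"
    proof (intro equalityI subsetI)
      fix m assume "m \<in> range f"
      then obtain z where "m = f z" by auto
      moreover obtain a b c d where "z = quaternion i j a b c d" using ex by blast
      ultimately show "m \<in> ordinary_quaternion_algebra"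
        by (auto simp: f ordinary_quaternion_algebra_def)
    next
      fix m :: "'f adjoin_i^2^2" assume "m \<in> ordinary_quaternion_algebra"
      then show "m \<in> range f"
        by (auto simp: ordinary_quaternion_algebra_def simp flip: f)
    qed
  qed
  moreover have "f (x + y) = f x + f y \<and> f (x * y) = f x ** f y" for x y
  proof -
    obtain a b c d where "x = quaternion i j a b c d" using ex by blast
    moreover obtain a' b' c' d' where "y = quaternion i j a' b' c' d'" using ex by blast
    ultimately show ?thesis
      by (simp add: quaternion_add quaternion_mult[OF ii jj ji] f ordinary_quaternion_matrix_add
          ordinary_quaternion_matrix_mult)
  qed
  moreover have "f (emb a) = mat (Adj a 0)" for a
    using f[of a 0 0 0] by (simp add: quaternion_def emb_zero mat_eq_ordinary_quaternion_matrix)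
  ultimately show ?thesis
    unfolding is_ordinary_quaternion_skew_field_def by blast
qed

text \<open>
  Suppose \<open>2 \<noteq> 0\<close>.  The field \<open>F(i)\<close> contains a square root of \<open>b = j\<^sup>2\<close>, so \<open>b = v\<^sup>2 a\<close>,
  and then \<open>i j / (v a)\<close> squares to \<open>-1\<close>.  Hence every maximal subfield contains a square
  root of \<open>-1\<close>, which is never central.  In \<open>F(i)\<close> and \<open>F(j)\<close> these roots are multiples of
  \<open>i\<close> and \<open>j\<close>.  Applied to \<open>F(x i + y j)\<close> with \<open>i\<^sup>2 = j\<^sup>2 = -1\<close> they show that \<open>x\<^sup>2 + y\<^sup>2\<close> is a
  square.
\<close>

lemma all_conjugate_imp_ordinary:
  assumes conj: "\<And>K L :: 'h set. maximal_subfield K \<Longrightarrow> maximal_subfield L \<Longrightarrow> conjugate K L"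
    and two: "(2::'f) \<noteq> 0" and a: "a \<noteq> 0" and b: "b \<noteq> 0"
    and i: "i * i = emb a" and j: "j * j = emb b" and ji: "j * i = - (i * j)"
    and span: "span {1, i, j, i * j} = UNIV"
  shows "formally_real TYPE('f) \<and> pythagorean TYPE('f) \<and> is_ordinary_quaternion_skew_field"
proof -
  have ij0: "i \<noteq> 0" "j \<noteq> 0"
    using i j a b by (auto simp: emb_eq_zero_iff[symmetric])
  then have ne: "j * i \<noteq> i * j"
    using neq_uminus_self[OF two, of "i * j"] by (auto simp: ji)
  then have nc: "i \<notin> range emb" "j \<notin> range emb"
    unfolding not_central_iff by metis+
  have root: "\<exists>y\<in>centralizer x. y \<notin> range emb \<and> y * y = emb c"
    if "x \<notin> range emb" "w \<notin> range emb" "w * w = emb c" for x w c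
    using that square_root_in_conjugate[of "centralizer w" "centralizer x" w c]
      conj[of "centralizer w" "centralizer x"] maximal_subfield_centralizer
    by (auto simp: centralizer_def)
  obtain y where "y \<in> centralizer i" "y \<notin> range emb" "y * y = emb b"
    using root[OF nc j] by blast
  then obtain v where v: "v \<noteq> 0" "v * v * a = b"
    using central_square_in_centralizer[OF two nc(1) i] by metis
  define k where "k = emb (1 / (v * a)) * (i * j)"
  have k_nc: "k \<notin> range emb"
  proof
    assume "k \<in> range emb"
    then obtain c where c: "k = emb c" by auto
    have "i * j = emb (v * a) * k"
      using v a by (simp add: k_def emb_one flip: mult.assoc emb_mult)
    then have "i * j = emb (v * a * c)"
      by (simp add: c emb_mult)
    then have "i * (i * j) = i * j * i"
      by (simp add: emb_commute)
    with ij0 have "i * j = j * i"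
      by (simp add: mult.assoc)
    with ne show False by simp
  qed
  have kk: "k * k = emb (- 1)"
  proof -
    have "i * j * (i * j) = i * (j * i) * j"
      by (simp add: mult.assoc)
    also have "\<dots> = - (i * i * (j * j))"
      by (simp add: ji mult.assoc)
    also have "\<dots> = emb (- (a * b))"
      by (simp add: i j emb_mult emb_minus)
    finally have "k * k = emb (1 / (v * a) * (1 / (v * a)) * - (a * b))"
      by (simp only: k_def scaled_mult_scaled emb_mult)
    also have "1 / (v * a) * (1 / (v * a)) * - (a * b) = - 1"
      using v(1) a by (simp add: field_simps flip: v(2))
    finally show ?thesis .
  qed
  have no_root: "x\<^sup>2 \<noteq> - 1" for x :: 'f
  proof
    assume x: "x\<^sup>2 = - 1"
    have "(k - emb x) * (k + emb x) = k * k - emb (x\<^sup>2)"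
      by (simp add: algebra_simps emb_commute[of x k] power2_eq_square flip: emb_mult)
    also have "\<dots> = 0"
      by (simp add: kk x)
    finally have "k = emb x \<or> k = emb (- x)"
      by (simp add: emb_minus add_eq_0_iff2)
    with k_nc show False by blast
  qed
  obtain p where p: "p \<noteq> 0" "emb p * i * (emb p * i) = emb (- 1)"
    using root[OF nc(1) k_nc kk] central_square_in_centralizer[OF two nc(1) i] by metis
  obtain q where q: "q \<noteq> 0" "emb q * j * (emb q * j) = emb (- 1)"
    using root[OF nc(2) k_nc kk] central_square_in_centralizer[OF two nc(2) j] by metis
  define I where "I = emb p * i"
  define J where "J = emb q * j"
  have II: "I * I = - 1" and JJ: "J * J = - 1"
    using p q by (simp_all add: I_def J_def emb_minus emb_one)
  have IJ: "I * J = emb (p * q) * (i * j)"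
    by (simp only: I_def J_def scaled_mult_scaled)
  have "J * I = emb (p * q) * (j * i)"
    by (simp only: I_def J_def scaled_mult_scaled mult.commute[of p q])
  then have JI: "J * I = - (I * J)"
    by (simp add: IJ ji)
  have I_nc: "I \<notin> range emb"
  proof
    assume "I \<in> range emb"
    then have "J * I = I * J" by (auto simp: emb_commute)
    moreover have "I * J \<noteq> 0" using II JJ by auto
    ultimately show False using JI neq_uminus_self[OF two, of "I * J"] by simp
  qed
  have "span {1, I, J, I * J} = UNIV"
  proof -
    have scaled: "z \<in> span {1, I, J, I * J}" if "emb r * z \<in> span {1, I, J, I * J}" "r \<noteq> 0" for r z
    proof -
      have "emb (inverse r) * (emb r * z) \<in> span {1, I, J, I * J}"
        using that(1) by (rule span_scale)
      with that(2) show ?thesis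
        by (simp add: emb_one)
    qed
    note base = span_base[of _ "{1, I, J, I * J}"]
    have "i \<in> span {1, I, J, I * J}"
      using p(1) scaled[of p i] base[of I] by (simp flip: I_def)
    moreover have "j \<in> span {1, I, J, I * J}"
      using q(1) scaled[of q j] base[of J] by (simp flip: J_def)
    moreover have "i * j \<in> span {1, I, J, I * J}"
      using p(1) q(1) scaled[of "p * q" "i * j"] base[of "I * J"] by (simp flip: IJ)
    moreover have "1 \<in> span {1, I, J, I * J}"
      using base[of 1] by simp
    ultimately have "span {1, i, j, i * j} \<subseteq> span {1, I, J, I * J}"
      by (intro span_minimal subspace_span) auto
    with span show ?thesis by blast
  qed
  with II JJ JI two have ord: is_ordinary_quaternion_skew_field
    by (intro ordinary_if_standard_basis)
  have "\<exists>z. x\<^sup>2 + y\<^sup>2 = z\<^sup>2" for x y :: 'f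
  proof (cases "y = 0")
    case True
    then show ?thesis by (intro exI[of _ x]) simp
  next
    case False
    define w where "w = emb x * I + emb y * J"
    have comm: "I * (emb r * z) = emb r * (I * z)" "J * (emb r * z) = emb r * (J * z)" for r z
      by (metis emb_commute mult.assoc)+
    have ww: "w * w = emb (- (x\<^sup>2 + y\<^sup>2))"
      by (simp only: w_def distrib_left distrib_right scaled_mult_scaled)
        (simp add: II JJ JI mult.commute[of y x] emb_diff emb_minus power2_eq_square)
    have w_nc: "w \<notin> range emb"
    proof
      assume "w \<in> range emb"
      then have "w * I = I * w" by (auto simp: emb_commute)
      then have "emb y * (J * I) = emb y * (I * J)"
        by (simp add: w_def algebra_simps comm)
      then have "J * I = I * J"
        using False by (simp add: emb_eq_zero_iff)
      moreover have "I * J \<noteq> 0" using II JJ by auto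
      ultimately show False using JI neq_uminus_self[OF two, of "I * J"] by simp
    qed
    obtain r where r: "r \<noteq> 0" "r * r * - (x\<^sup>2 + y\<^sup>2) = - 1"
      using root[OF w_nc k_nc kk] central_square_in_centralizer[OF two w_nc ww] by metis
    then have "x\<^sup>2 + y\<^sup>2 = (1 / r)\<^sup>2"
      by (simp add: field_simps power2_eq_square)
    then show ?thesis by blast
  qed
  with no_root ord show ?thesis
    by (auto simp: formally_real_def pythagorean_def)
qed

end

section \<open>The equivalence\<close>

sublocale quaternion_skew_field \<subseteq> four_dimensional_skew_field
  using quaternion_algebra by unfold_locales (simp add: quaternion_algebra_def)

theorem theorem4p12:
  fixes emb :: "'f::field \<Rightarrow> 'h::division_ring"
  assumes "quaternion_skew_field emb"
  shows "((formally_real TYPE('f) \<and> pythagorean TYPE('f) \<and>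
           skew_field_with_centre.is_ordinary_quaternion_skew_field emb) \<longleftrightarrow>
          (\<forall>K L. maximal_subfield K \<and> maximal_subfield L \<longrightarrow>
             skew_field_with_centre.F_isomorphic emb K L)) \<and>
         ((\<forall>K L. maximal_subfield K \<and> maximal_subfield L \<longrightarrow>
             skew_field_with_centre.F_isomorphic emb K L) \<longleftrightarrow>
          {R. skew_field_with_centre.clifford_like emb R} =
            {skew_field_with_centre.left_parallel emb, skew_field_with_centre.right_parallel emb})"
proof -
  interpret quaternion_skew_field emb by (rule assms)
  have iso: "(\<forall>K L. maximal_subfield K \<and> maximal_subfield L \<longrightarrow> F_isomorphic K L)
      \<longleftrightarrow> (\<forall>K L :: 'h set. maximal_subfield K \<and> maximal_subfield L \<longrightarrow> conjugate K L)"
    using F_isomorphic_iff_conjugate by auto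
  have "formally_real TYPE('f) \<and> pythagorean TYPE('f) \<and> is_ordinary_quaternion_skew_field"
    if conj: "\<And>K L :: 'h set. maximal_subfield K \<Longrightarrow> maximal_subfield L \<Longrightarrow> conjugate K L"
  proof -
    obtain a b i j where span: "span {1, i, j, i * j} = UNIV"
      and gen: "if (2::'f) \<noteq> 0
        then a \<noteq> 0 \<and> b \<noteq> 0 \<and> i * i = emb a \<and> j * j = emb b \<and> j * i = - (i * j)
        else b \<noteq> 0 \<and> i * i + i = emb a \<and> j * j = emb b \<and> j * i = (i + 1) * j"
      using quaternion_algebra unfolding quaternion_algebra_def by blast
    show ?thesis
    proof (cases "(2::'f) = 0")
      case True
      with gen have "\<exists>K L :: 'h set. maximal_subfield K \<and> maximal_subfield L \<and> \<not> conjugate K L"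
        using char_2_not_all_conjugate[of b i a j] by simp
      with conj show ?thesis by blast
    next
      case False
      with gen span show ?thesis
        using all_conjugate_imp_ordinary[OF conj, of a b i j] by simp
    qed
  qed
  then have "formally_real TYPE('f) \<and> pythagorean TYPE('f) \<and> is_ordinary_quaternion_skew_field
      \<longleftrightarrow> (\<forall>K L :: 'h set. maximal_subfield K \<and> maximal_subfield L \<longrightarrow> conjugate K L)"
    using ordinary_imp_conjugate by blast
  then show ?thesis
    using all_conjugate_iff_only_clifford_parallelisms by (simp only: iso)
qed

end
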